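(* Let $\mathfrak{g}$ be an affine Lie algebra (untwisted or twisted, of any type). Given a positive integer $\ell$ and $\lambda\in \mathring{P}^+$, there exist $\mu\in M^+$ and $w\in \mathring{W}$ such that $w\,t_\mu(\ell\Lambda_0-\lambda)\in P^+$.
   Context: Base field $\mathbb{C}$; conventions are those of Kac's book "Infinite dimensional Lie algebras". Let $\mathfrak{g}$ be the affine Kac–Moody Lie algebra of an indecomposable affine Cartan matrix whose Dynkin diagram (Kac, Tables Aff 1–3) has vertices labelled $0,1,\dots,n$ as in Kac. Let $\mathring{\mathfrak{g}}\subset\mathfrak{g}$ be the finite-dimensional simple Lie algebra whose Dynkin diagram is obtained by removing vertex $0$; $\mathfrak{h}$ and $\mathring{\mathfrak{h}}$ are the Cartan subalgebras, $\mathfrak{h}=\mathring{\mathfrak{h}}\oplus\mathbb{C}c\oplus\mathbb{C}d$ with $c$ the canonical central element and $d$ the scaling element; $\mathring{\mathfrak{h}}^*$ is regarded as a subspace of $\mathfrak{h}^*$ by extending by $0$ on $c$ and $d$. Real forms are denoted by a subscript $\mathbb{R}$. Let $\alpha_0,\dots,\alpha_n$ be the simple roots, $\alpha_0^\vee,\dots,\alpha_n^\vee$ the simple coroots, $\delta$ the indivisible positive imaginary root, and $\langle\,,\rangle$ the standard (normalized) nondegenerate symmetric invariant form on $\mathfrak{g}$, also transported to $\mathfrak{h}^*$. $P=\{\Lambda\in\mathfrak{h}^*:\Lambda(\alpha_i^\vee)\in\mathbb{Z},\ 0\le i\le n\}$ is the weight lattice of $\mathfrak{g}$ and $P^+=\{\Lambda\in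 P:\Lambda(\alpha_i^\vee)\ge 0,\ 0\le i\le n\}$ is the set of dominant integral weights (so $P^+$ is stable under adding multiples of $\delta$). $\mathring{P}$ is the weight lattice of $\mathring{\mathfrak{g}}$ and $\mathring{P}^+=\{\lambda\in\mathring{P}:\lambda(\alpha_i^\vee)\ge0,\ 1\le i\le n\}$. $\Lambda_0\in P^+$ is the fundamental weight with $\Lambda_0(\alpha_i^\vee)=\delta_{i,0}$ for $0\le i\le n$ and $\Lambda_0(d)=0$; then $\Lambda_0(c)=1$. $\mathring{W}=\langle s_1,\dots,s_n\rangle$ is the Weyl group of $\mathring{\mathfrak{g}}$, where $s_i$ is the reflection in $\alpha_i$; it acts on $\mathfrak{h}^*$. For $\alpha\in\mathring{\mathfrak{h}}^*$, the map $t_\alpha:\mathfrak{h}^*\to\mathfrak{h}^*$ is $$t_\alpha(\Lambda)=\Lambda+\Lambda(c)\,\alpha-\Big(\langle\Lambda,\alpha\rangle+\tfrac{\langle\alpha,\alpha\rangle}{2}\Lambda(c)\Big)\delta .$$ Put $a_0=2$ if $\mathfrak{g}$ is of type $A_{2n}^{(2)}$ $(n\ge1)$ and $a_0=1$ otherwise, and $\theta=\delta-a_0\alpha_0$; this is the highest root of $\mathring{\mathfrak{g}}$ if $\mathfrak{g}$ is untwisted or of type $A_{2n}^{(2)}$, and the highest short root of $\mathring{\mathfrak{g}}$ for the other twisted types. $M\subset\mathring{\mathfrak{h}}^*_{\mathbb{R}}$ is the lattice generated by the elements $w\big(\tfrac{1}{a_0}\theta\big)$, $w\in\mathring{W}$;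 the affine Weyl group of $\mathfrak{g}$ is $W=\mathring{W}\ltimes\{t_\mu:\mu\in M\}$. Finally $\bar C=\{\lambda\in\mathring{\mathfrak{h}}^*_{\mathbb{R}}:\lambda(\alpha_i^\vee)\ge0,\ 1\le i\le n\}$ is the closed fundamental Weyl chamber and $M^+=M\cap\bar C$. *)

theory Defs
  imports Complex_Main
begin

section \<open>Affine Dynkin diagrams\<close>

text \<open>
  The constructors follow Kac, \<^emph>\<open>Infinite dimensional Lie algebras\<close>, Tables Aff 1, Aff 2 and Aff 3:
  \<open>AffA n\<close> is $A_n^{(1)}$ and so on for Aff 1; \<open>TwA_even n\<close> is $A_{2n}^{(2)}$,
  \<open>TwA_odd n\<close> is $A_{2n-1}^{(2)}$, \<open>TwD n\<close> is $D_{n+1}^{(2)}$, \<open>TwE6\<close> is $E_6^{(2)}$ and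
  \<open>TwD4\<close> is $D_4^{(3)}$.  In every case the vertices are \<open>0, \<dots>, n\<close> with \<open>n = aff_rank X\<close>,
  enumerated as in Kac.
\<close>

datatype affine_type =
    AffA nat | AffB nat | AffC nat | AffD nat
  | AffE6 | AffE7 | AffE8 | AffF4 | AffG2
  | TwA_even nat | TwA_odd nat | TwD nat | TwE6
  | TwD4

fun in_tables :: "affine_type \<Rightarrow> bool" where
  "in_tables (AffA n) \<longleftrightarrow> n \<ge> 1"
| "in_tables (AffB n) \<longleftrightarrow> n \<ge> 3"
| "in_tables (AffC n) \<longleftrightarrow> n \<ge> 2"
| "in_tables (AffD n) \<longleftrightarrow> n \<ge> 4"
| "in_tables (TwA_even n) \<longleftrightarrow> n \<ge> 1"
| "in_tables (TwA_odd n) \<longleftrightarrow> n \<ge> 3"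
| "in_tables (TwD n) \<longleftrightarrow> n \<ge> 2"
| "in_tables _ \<longleftrightarrow> True"

fun aff_rank :: "affine_type \<Rightarrow> nat" where
  "aff_rank (AffA n) = n"
| "aff_rank (AffB n) = n"
| "aff_rank (AffC n) = n"
| "aff_rank (AffD n) = n"
| "aff_rank AffE6 = 6"
| "aff_rank AffE7 = 7"
| "aff_rank AffE8 = 8"
| "aff_rank AffF4 = 4"
| "aff_rank AffG2 = 2"
| "aff_rank (TwA_even n) = n"
| "aff_rank (TwA_odd n) = n"
| "aff_rank (TwD n) = n"
| "aff_rank TwE6 = 4"
| "aff_rank TwD4 = 2"

definition path_edges :: "nat \<Rightarrow> nat \<Rightarrow> (nat \<times> nat) set" where
  "path_edges k l = {(i, Suc i) | i. k \<le> i \<and> i < l}"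

text \<open>Each pair of joined vertices is listed in at least one of its two orders.\<close>

fun edges :: "affine_type \<Rightarrow> (nat \<times> nat) set" where
  "edges (AffA n) = path_edges 0 n \<union> {(n, 0)}"
| "edges (AffB n) = path_edges 1 n \<union> {(0, 2)}"
| "edges (AffC n) = path_edges 0 n"
| "edges (AffD n) = path_edges 1 (n - 1) \<union> {(0, 2), (n - 2, n)}"
| "edges AffE6 = path_edges 1 5 \<union> {(0, 6), (6, 3)}"
| "edges AffE7 = path_edges 0 6 \<union> {(7, 3)}"
| "edges AffE8 = path_edges 0 7 \<union> {(8, 5)}"
| "edges AffF4 = path_edges 0 4"
| "edges AffG2 = path_edges 0 2"
| "edges (TwA_even n) = path_edges 0 n"
| "edges (TwA_odd n) = path_edges 1 n \<union> {(0, 2)}"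
| "edges (TwD n) = path_edges 0 n"
| "edges TwE6 = path_edges 0 4"
| "edges TwD4 = path_edges 0 2"

text \<open>
  \<open>lines X i j\<close> is \<open>- a\<^sub>i\<^sub>j\<close> for joined vertices \<open>i\<close> and \<open>j\<close>.  In Kac's convention a multiple edge
  carries an arrow pointing towards \<open>i\<close> when \<open>- a\<^sub>i\<^sub>j > 1\<close>, that is, towards the shorter root.
\<close>

fun lines :: "affine_type \<Rightarrow> nat \<Rightarrow> nat \<Rightarrow> int" where
  "lines (AffA n) i j = (if n = 1 then 2 else 1)"
| "lines (AffB n) i j = (if (i, j) = (n, n - 1) then 2 else 1)"
| "lines (AffC n) i j = (if (i, j) \<in> {(1, 0), (n - 1, n)} then 2 else 1)"
| "lines AffF4 i j = (if (i, j) = (3, 2) then 2 else 1)"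
| "lines AffG2 i j = (if (i, j) = (2, 1) then 3 else 1)"
| "lines (TwA_even n) i j =
    (if n = 1 then (if (i, j) = (0, 1) then 4 else 1)
     else if (i, j) \<in> {(0, 1), (n - 1, n)} then 2 else 1)"
| "lines (TwA_odd n) i j = (if (i, j) = (n - 1, n) then 2 else 1)"
| "lines (TwD n) i j = (if (i, j) \<in> {(0, 1), (n, n - 1)} then 2 else 1)"
| "lines TwE6 i j = (if (i, j) = (2, 3) then 2 else 1)"
| "lines TwD4 i j = (if (i, j) = (1, 2) then 3 else 1)"
| "lines _ i j = 1"

definition cartan_matrix :: "affine_type \<Rightarrow> nat \<Rightarrow> nat \<Rightarrow> int" where
  "cartan_matrix X i j =
    (if i = j then 2
     else if (i, j) \<in> edges X \<or> (j, i) \<in> edges X then - lines X i j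
     else 0)"

text \<open>
  The numerical labels \<open>a\<^sub>i\<close> of the diagram, and the labels \<open>a\<^sub>i\<^sup>\<or>\<close> of the diagram with all arrows
  reversed and the same enumeration of the vertices.  They are the coprime positive integers with
  \<open>\<Sum>\<^sub>j a\<^sub>i\<^sub>j a\<^sub>j = 0\<close> and \<open>\<Sum>\<^sub>i a\<^sub>i\<^sup>\<or> a\<^sub>i\<^sub>j = 0\<close>.
\<close>

fun mark :: "affine_type \<Rightarrow> nat \<Rightarrow> nat" where
  "mark (AffA n) i = 1"
| "mark (AffB n) i = (if i \<in> {0, 1} then 1 else 2)"
| "mark (AffC n) i = (if i \<in> {0, n} then 1 else 2)"
| "mark (AffD n) i = (if i \<in> {0, 1, n - 1, n} then 1 else 2)"
| "mark AffE6 i = [1, 1, 2, 3, 2, 1, 2] ! i"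
| "mark AffE7 i = [1, 2, 3, 4, 3, 2, 1, 2] ! i"
| "mark AffE8 i = [1, 2, 3, 4, 5, 6, 4, 2, 3] ! i"
| "mark AffF4 i = [1, 2, 3, 4, 2] ! i"
| "mark AffG2 i = [1, 2, 3] ! i"
| "mark (TwA_even n) i = (if i = n then 1 else 2)"
| "mark (TwA_odd n) i = (if i \<in> {0, 1, n} then 1 else 2)"
| "mark (TwD n) i = 1"
| "mark TwE6 i = [1, 2, 3, 2, 1] ! i"
| "mark TwD4 i = [1, 2, 1] ! i"

fun comark :: "affine_type \<Rightarrow> nat \<Rightarrow> nat" where
  "comark (AffB n) i = (if i \<in> {0, 1, n} then 1 else 2)"
| "comark (AffC n) i = 1"
| "comark AffF4 i = [1, 2, 3, 2, 1] ! i"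
| "comark AffG2 i = [1, 2, 1] ! i"
| "comark (TwA_even n) i = (if i = 0 then 1 else 2)"
| "comark (TwA_odd n) i = (if i \<in> {0, 1} then 1 else 2)"
| "comark (TwD n) i = (if i \<in> {0, n} then 1 else 2)"
| "comark TwE6 i = [1, 2, 3, 4, 2] ! i"
| "comark TwD4 i = [1, 2, 3] ! i"
| "comark X i = mark X i"


section \<open>Affine Kac--Moody algebras\<close>

text \<open>The underlying vector space of the Lie algebra is the whole type \<open>'g\<close>.\<close>

record 'g affine_data =
  dynkin :: affine_type
  smult :: "complex \<Rightarrow> 'g \<Rightarrow> 'g"
  lie :: "'g \<Rightarrow> 'g \<Rightarrow> 'g"
  cartan :: "'g set"
  chev_e :: "nat \<Rightarrow> 'g"
  chev_f :: "nat \<Rightarrow> 'g"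
  coroot :: "nat \<Rightarrow> 'g"
  root :: "nat \<Rightarrow> 'g \<Rightarrow> complex"
  scaling :: 'g
  form :: "'g \<Rightarrow> 'g \<Rightarrow> complex"

abbreviation rk :: "'g affine_data \<Rightarrow> nat" where
  "rk \<gg> \<equiv> aff_rank (dynkin \<gg>)"

abbreviation GCM :: "'g affine_data \<Rightarrow> nat \<Rightarrow> nat \<Rightarrow> int" where
  "GCM \<gg> \<equiv> cartan_matrix (dynkin \<gg>)"

definition lie_algebra :: "'g::ab_group_add affine_data \<Rightarrow> bool" where
  "lie_algebra \<gg> \<longleftrightarrow>
    vector_space (smult \<gg>) \<and>
    (\<forall>x. Vector_Spaces.linear (smult \<gg>) (smult \<gg>) (lie \<gg> x)) \<and>
    (\<forall>y. Vector_Spaces.linear (smult \<gg>) (smult \<gg>) (\<lambda>x. lie \<gg> x y)) \<and>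
    (\<forall>x. lie \<gg> x x = 0) \<and>
    (\<forall>x y z. lie \<gg> x (lie \<gg> y z) + lie \<gg> y (lie \<gg> z x) + lie \<gg> z (lie \<gg> x y) = 0)"

text \<open>
  A functional on the Cartan subalgebra is encoded as a function on all of \<open>'g\<close> which vanishes
  outside the Cartan subalgebra, so that equality of functionals is equality of functions.
\<close>

definition dual :: "'g::ab_group_add affine_data \<Rightarrow> ('g \<Rightarrow> complex) set" where
  "dual \<gg> = {\<Lambda>.
    (\<forall>x\<in>cartan \<gg>. \<forall>y\<in>cartan \<gg>. \<Lambda> (x + y) = \<Lambda> x + \<Lambda> y) \<and>
    (\<forall>a. \<forall>x\<in>cartan \<gg>. \<Lambda> (smult \<gg> a x) = a * \<Lambda> x) \<and>
    (\<forall>x. x \<notin> cartan \<gg> \<longrightarrow> \<Lambda> x = 0)}"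

text \<open>
  Realization of an affine matrix: the matrix has size \<open>n + 1\<close> and rank \<open>n\<close>, so the Cartan subalgebra
  has dimension \<open>2 (n + 1) - n\<close>.
\<close>

definition realization :: "'g::ab_group_add affine_data \<Rightarrow> bool" where
  "realization \<gg> \<longleftrightarrow>
    module.subspace (smult \<gg>) (cartan \<gg>) \<and>
    vector_space.dim (smult \<gg>) (cartan \<gg>) = rk \<gg> + 2 \<and>
    (\<forall>i\<le>rk \<gg>. coroot \<gg> i \<in> cartan \<gg>) \<and>
    (\<forall>i\<le>rk \<gg>. root \<gg> i \<in> dual \<gg>) \<and>
    (\<forall>k. (\<Sum>i\<le>rk \<gg>. smult \<gg> (k i) (coroot \<gg> i)) = 0 \<longrightarrow> (\<forall>i\<le>rk \<gg>. k i = 0)) \<and>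
    (\<forall>k. (\<forall>x. (\<Sum>i\<le>rk \<gg>. k i * root \<gg> i x) = 0) \<longrightarrow> (\<forall>i\<le>rk \<gg>. k i = 0)) \<and>
    (\<forall>i\<le>rk \<gg>. \<forall>j\<le>rk \<gg>. root \<gg> j (coroot \<gg> i) = of_int (GCM \<gg> i j))"

text \<open>
  The Kac--Moody algebra of a generalized Cartan matrix: it is generated by a realization and
  Chevalley generators subject to the relations below, and has no nonzero ideal meeting the
  Cartan subalgebra trivially.
\<close>

definition kac_moody :: "'g::ab_group_add affine_data \<Rightarrow> bool" where
  "kac_moody \<gg> \<longleftrightarrow> lie_algebra \<gg> \<and> realization \<gg> \<and>
    (\<forall>i\<le>rk \<gg>. \<forall>j\<le>rk \<gg>. lie \<gg> (chev_e \<gg> i) (chev_f \<gg> j) = (if i = j then coroot \<gg> i else 0)) \<and>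
    (\<forall>x\<in>cartan \<gg>. \<forall>y\<in>cartan \<gg>. lie \<gg> x y = 0) \<and>
    (\<forall>x\<in>cartan \<gg>. \<forall>i\<le>rk \<gg>. lie \<gg> x (chev_e \<gg> i) = smult \<gg> (root \<gg> i x) (chev_e \<gg> i)) \<and>
    (\<forall>x\<in>cartan \<gg>. \<forall>i\<le>rk \<gg>. lie \<gg> x (chev_f \<gg> i) = smult \<gg> (- root \<gg> i x) (chev_f \<gg> i)) \<and>
    (\<forall>S. module.subspace (smult \<gg>) S \<and> (\<forall>x\<in>S. \<forall>y\<in>S. lie \<gg> x y \<in> S) \<and>
         cartan \<gg> \<subseteq> S \<and> (\<forall>i\<le>rk \<gg>. chev_e \<gg> i \<in> S \<and> chev_f \<gg> i \<in> S) \<longrightarrow> S = UNIV) \<and>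
    (\<forall>I. module.subspace (smult \<gg>) I \<and> (\<forall>x. \<forall>y\<in>I. lie \<gg> x y \<in> I) \<and>
         I \<inter> cartan \<gg> = {0} \<longrightarrow> I = {0})"

definition scaling_element :: "'g::ab_group_add affine_data \<Rightarrow> bool" where
  "scaling_element \<gg> \<longleftrightarrow> scaling \<gg> \<in> cartan \<gg> \<and>
    (\<forall>i\<le>rk \<gg>. root \<gg> i (scaling \<gg>) = (if i = 0 then 1 else 0))"

text \<open>
  The normalized invariant form is the invariant extension of the form on the Cartan subalgebra
  given by the values on \<open>\<alpha>\<^sub>0\<^sup>\<or>, \<dots>, \<alpha>\<^sub>n\<^sup>\<or>, d\<close> below (Kac, (6.2.1)).
\<close>

definition normalized_invariant_form :: "'g::ab_group_add affine_data \<Rightarrow> bool" where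
  "normalized_invariant_form \<gg> \<longleftrightarrow>
    (\<forall>x. Vector_Spaces.linear (smult \<gg>) (*) (form \<gg> x)) \<and>
    (\<forall>x y. form \<gg> x y = form \<gg> y x) \<and>
    (\<forall>x y z. form \<gg> (lie \<gg> x y) z = form \<gg> x (lie \<gg> y z)) \<and>
    (\<forall>x. (\<forall>y. form \<gg> x y = 0) \<longrightarrow> x = 0) \<and>
    (\<forall>i\<le>rk \<gg>. \<forall>j\<le>rk \<gg>. form \<gg> (coroot \<gg> i) (coroot \<gg> j) =
        of_nat (mark (dynkin \<gg>) j) / of_nat (comark (dynkin \<gg>) j) * of_int (GCM \<gg> i j)) \<and>
    (\<forall>i\<le>rk \<gg>. form \<gg> (coroot \<gg> i) (scaling \<gg>) =
        (if i = 0 then of_nat (mark (dynkin \<gg>) 0) else 0)) \<and>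
    form \<gg> (scaling \<gg>) (scaling \<gg>) = 0"

definition affine_lie_algebra :: "'g::ab_group_add affine_data \<Rightarrow> bool" where
  "affine_lie_algebra \<gg> \<longleftrightarrow>
    in_tables (dynkin \<gg>) \<and> kac_moody \<gg> \<and> scaling_element \<gg> \<and> normalized_invariant_form \<gg>"


section \<open>Weights\<close>

definition central :: "'g::ab_group_add affine_data \<Rightarrow> 'g" where
  "central \<gg> = (\<Sum>i\<le>rk \<gg>. smult \<gg> (of_nat (comark (dynkin \<gg>) i)) (coroot \<gg> i))"

text \<open>\<open>\<delta> = \<Sum> a\<^sub>i \<alpha>\<^sub>i\<close>, whose positive multiples are the positive imaginary roots (Kac, Theorem 5.6).\<close>

definition null_root :: "'g affine_data \<Rightarrow> 'g \<Rightarrow> complex" where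
  "null_root \<gg> x = (\<Sum>i\<le>rk \<gg>. of_nat (mark (dynkin \<gg>) i) * root \<gg> i x)"

text \<open>The form on the dual, transported along \<open>x \<mapsto> \<langle>x, _\<rangle>\<close>.\<close>

definition dual_to_cartan :: "'g affine_data \<Rightarrow> ('g \<Rightarrow> complex) \<Rightarrow> 'g" where
  "dual_to_cartan \<gg> \<Lambda> = (THE x. x \<in> cartan \<gg> \<and> (\<forall>y\<in>cartan \<gg>. form \<gg> x y = \<Lambda> y))"

definition dual_form :: "'g affine_data \<Rightarrow> ('g \<Rightarrow> complex) \<Rightarrow> ('g \<Rightarrow> complex) \<Rightarrow> complex" where
  "dual_form \<gg> \<Lambda> M = form \<gg> (dual_to_cartan \<gg> \<Lambda>) (dual_to_cartan \<gg> M)"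

definition weight_lattice :: "'g::ab_group_add affine_data \<Rightarrow> ('g \<Rightarrow> complex) set" where
  "weight_lattice \<gg> = {\<Lambda> \<in> dual \<gg>. \<forall>i\<le>rk \<gg>. \<Lambda> (coroot \<gg> i) \<in> \<int>}"

definition dominant_weights :: "'g::ab_group_add affine_data \<Rightarrow> ('g \<Rightarrow> complex) set" where
  "dominant_weights \<gg> = {\<Lambda> \<in> weight_lattice \<gg>. \<forall>i\<le>rk \<gg>. 0 \<le> Re (\<Lambda> (coroot \<gg> i))}"

definition Lambda0 :: "'g::ab_group_add affine_data \<Rightarrow> 'g \<Rightarrow> complex" where
  "Lambda0 \<gg> = (THE \<Lambda>. \<Lambda> \<in> dual \<gg> \<and>
    (\<forall>i\<le>rk \<gg>. \<Lambda> (coroot \<gg> i) = (if i = 0 then 1 else 0)) \<and> \<Lambda> (scaling \<gg>) = 0)"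

text \<open>
  The prefix \<open>fin_\<close> marks objects of the finite-dimensional simple Lie algebra obtained by removing
  vertex \<open>0\<close>; its dual Cartan subalgebra is the annihilator of \<open>c\<close> and \<open>d\<close>.
\<close>

definition fin_dual :: "'g::ab_group_add affine_data \<Rightarrow> ('g \<Rightarrow> complex) set" where
  "fin_dual \<gg> = {\<Lambda> \<in> dual \<gg>. \<Lambda> (central \<gg>) = 0 \<and> \<Lambda> (scaling \<gg>) = 0}"

definition fin_dual_real :: "'g::ab_group_add affine_data \<Rightarrow> ('g \<Rightarrow> complex) set" where
  "fin_dual_real \<gg> = {\<Lambda> \<in> fin_dual \<gg>. \<forall>i\<in>{1..rk \<gg>}. \<Lambda> (coroot \<gg> i) \<in> \<real>}"

definition fin_weight_lattice :: "'g::ab_group_add affine_data \<Rightarrow> ('g \<Rightarrow> complex) set" where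
  "fin_weight_lattice \<gg> = {\<Lambda> \<in> fin_dual \<gg>. \<forall>i\<in>{1..rk \<gg>}. \<Lambda> (coroot \<gg> i) \<in> \<int>}"

definition fin_dominant_weights :: "'g::ab_group_add affine_data \<Rightarrow> ('g \<Rightarrow> complex) set" where
  "fin_dominant_weights \<gg> =
    {\<Lambda> \<in> fin_weight_lattice \<gg>. \<forall>i\<in>{1..rk \<gg>}. 0 \<le> Re (\<Lambda> (coroot \<gg> i))}"

definition fin_chamber :: "'g::ab_group_add affine_data \<Rightarrow> ('g \<Rightarrow> complex) set" where
  "fin_chamber \<gg> = {\<Lambda> \<in> fin_dual_real \<gg>. \<forall>i\<in>{1..rk \<gg>}. 0 \<le> Re (\<Lambda> (coroot \<gg> i))}"

definition reflection :: "'g affine_data \<Rightarrow> nat \<Rightarrow> ('g \<Rightarrow> complex) \<Rightarrow> ('g \<Rightarrow> complex)" where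
  "reflection \<gg> i \<Lambda> = (\<lambda>x. \<Lambda> x - \<Lambda> (coroot \<gg> i) * root \<gg> i x)"

text \<open>Reflections are involutions, so closure under composition already yields the group.\<close>

inductive_set fin_weyl :: "'g affine_data \<Rightarrow> (('g \<Rightarrow> complex) \<Rightarrow> ('g \<Rightarrow> complex)) set"
  for \<gg> :: "'g affine_data" where
  id: "id \<in> fin_weyl \<gg>"
| reflect: "w \<in> fin_weyl \<gg> \<Longrightarrow> i \<in> {1..rk \<gg>} \<Longrightarrow> reflection \<gg> i \<circ> w \<in> fin_weyl \<gg>"

definition translation ::
    "'g::ab_group_add affine_data \<Rightarrow> ('g \<Rightarrow> complex) \<Rightarrow> ('g \<Rightarrow> complex) \<Rightarrow> ('g \<Rightarrow> complex)" where
  "translation \<gg> \<alpha> \<Lambda> = (\<lambda>x. \<Lambda> x + \<Lambda> (central \<gg>) * \<alpha> x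
     - (dual_form \<gg> \<Lambda> \<alpha> + dual_form \<gg> \<alpha> \<alpha> / 2 * \<Lambda> (central \<gg>)) * null_root \<gg> x)"

text \<open>Here \<open>mark (dynkin \<gg>) 0\<close> is \<open>2\<close> for $A_{2n}^{(2)}$ and \<open>1\<close> otherwise.\<close>

definition theta :: "'g affine_data \<Rightarrow> 'g \<Rightarrow> complex" where
  "theta \<gg> = (\<lambda>x. null_root \<gg> x - of_nat (mark (dynkin \<gg>) 0) * root \<gg> 0 x)"

inductive_set additive_span :: "('g \<Rightarrow> complex) set \<Rightarrow> ('g \<Rightarrow> complex) set"
  for S :: "('g \<Rightarrow> complex) set" where
  zero: "(\<lambda>x. 0) \<in> additive_span S"
| add: "\<Lambda> \<in> additive_span S \<Longrightarrow> \<beta> \<in> S \<Longrightarrow> (\<lambda>x. \<Lambda> x + \<beta> x) \<in> additive_span S"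
| sub: "\<Lambda> \<in> additive_span S \<Longrightarrow> \<beta> \<in> S \<Longrightarrow> (\<lambda>x. \<Lambda> x - \<beta> x) \<in> additive_span S"

definition lattice_M :: "'g affine_data \<Rightarrow> ('g \<Rightarrow> complex) set" where
  "lattice_M \<gg> =
    additive_span ((\<lambda>w. w (\<lambda>x. theta \<gg> x / of_nat (mark (dynkin \<gg>) 0))) ` fin_weyl \<gg>)"

definition lattice_M_plus :: "'g::ab_group_add affine_data \<Rightarrow> ('g \<Rightarrow> complex) set" where
  "lattice_M_plus \<gg> = lattice_M \<gg> \<inter> fin_chamber \<gg>"

end

theory Submission
  imports Defs
begin

text \<open>
  Modulo \<open>\<delta>\<close> the map \<open>t\<^sub>\<mu>\<close> sends \<open>\<ell>\<Lambda>\<^sub>0 - \<lambda>\<close> to \<open>\<ell>\<Lambda>\<^sub>0 + (\<ell>\<mu> - \<lambda>)\<close>, and \<open>\<delta>\<close> vanishes on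
  all coroots.  Choose \<open>\<mu> \<in> M\<close> with \<open>|\<ell>\<mu> - \<lambda>|\<^sup>2\<close> minimal; the values of this form are discrete and nonnegative.
  Since \<open>\<lambda>\<close> is dominant, passing to the dominant conjugate of \<open>\<mu>\<close> does not increase it.
  Let \<open>x = w(\<ell>\<mu> - \<lambda>)\<close> be dominant.  Minimality against \<open>\<mu> - w\<^sup>-\<^sup>1\<gamma>\<close> with \<open>\<gamma> = \<theta> / a\<^sub>0\<close> gives
  \<open>2\<langle>x, \<gamma>\<rangle> \<le> \<ell>|\<gamma>|\<^sup>2\<close>, which says precisely that \<open>\<ell>\<Lambda>\<^sub>0 + x\<close> is nonnegative on \<open>\<alpha>\<^sub>0\<^sup>\<or>\<close>.
\<close>

section \<open>Coordinate vectors of a finite Cartan matrix\<close>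

text \<open>Scaling by \<open>K\<close> and subtracting the integer floor of
  \<open>K * (b - c)\<close> turns the values, up to one fixed shift, into natural numbers, so
  well-ordering applies. The offset \<open>c\<close> allows values in a coset of a discrete
  group.\<close>

lemma discrete_bounded_below_attains_min:
  fixes f :: "'a \<Rightarrow> real" and K :: real
  assumes "S \<noteq> {}" and "K > 0"
    and bound: "\<And>x. x \<in> S \<Longrightarrow> b \<le> f x"
    and discrete: "\<And>x. x \<in> S \<Longrightarrow> K * (f x - c) \<in> \<int>"
  shows "\<exists>x\<in>S. \<forall>y\<in>S. f x \<le> f y"
proof -
  define g where "g x = nat (\<lfloor>K * (f x - c)\<rfloor> - \<lfloor>K * (b - c)\<rfloor>)" for x
  have g: "real (g x) = K * (f x - c) - of_int \<lfloor>K * (b - c)\<rfloor>" if "x \<in> S" for x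
  proof -
    have "\<lfloor>K * (b - c)\<rfloor> \<le> \<lfloor>K * (f x - c)\<rfloor>"
      using bound[OF that] \<open>K > 0\<close> by (intro floor_mono) simp
    moreover have "of_int \<lfloor>K * (f x - c)\<rfloor> = K * (f x - c)"
      using discrete[OF that] by (simp add: of_int_floor_cancel)
    ultimately show ?thesis
      unfolding g_def by (simp add: of_nat_nat)
  qed
  obtain x0 where "x0 \<in> S" using assms(1) by blast
  then obtain x where x: "x \<in> S" "\<And>y. y \<in> S \<Longrightarrow> g x \<le> g y"
    using ex_has_least_nat[of "\<lambda>x. x \<in> S" x0 g] by blast
  have "f x \<le> f y" if "y \<in> S" for y
  proof -
    have "real (g x) \<le> real (g y)" using x(2)[OF that] by simp
    then have "K * f x \<le> K * f y" using g[OF x(1)] g[OF that] by (simp add: algebra_simps)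
    then show ?thesis using \<open>K > 0\<close> by simp
  qed
  then show ?thesis using x(1) by blast
qed

text \<open>
  Vectors are coordinate vectors with respect to the simple roots \<open>\<alpha>\<^sub>j\<close>, \<open>j \<in> J\<close>; coordinates outside
  \<open>J\<close> are ignored.  Then \<open>co x i\<close> is \<open>x(\<alpha>\<^sub>i\<^sup>\<or>)\<close>, and \<open>bil\<close> is the invariant form with
  \<open>|\<alpha>\<^sub>i|\<^sup>2 = 2 e i\<close>.
\<close>

locale finite_cartan =
  fixes J :: "'i set" and a :: "'i \<Rightarrow> 'i \<Rightarrow> int" and e v :: "'i \<Rightarrow> real"
  assumes finite_J [simp]: "finite J"
    and e_pos: "i \<in> J \<Longrightarrow> e i > 0"
    and v_pos: "i \<in> J \<Longrightarrow> v i > 0"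
    and a_diag: "i \<in> J \<Longrightarrow> a i i = 2"
    and a_offdiag: "i \<in> J \<Longrightarrow> j \<in> J \<Longrightarrow> i \<noteq> j \<Longrightarrow> a i j \<le> 0"
    and a_symm: "i \<in> J \<Longrightarrow> j \<in> J \<Longrightarrow> e i * of_int (a i j) = e j * of_int (a j i)"
    and a_v: "i \<in> J \<Longrightarrow> (\<Sum>j\<in>J. of_int (a i j) * v j) \<ge> 0"
    and a_surj: "\<exists>q. \<forall>i\<in>J. (\<Sum>j\<in>J. of_int (a i j) * q j) = (p i :: real)"
begin

definition co :: "('i \<Rightarrow> real) \<Rightarrow> 'i \<Rightarrow> real" where
  "co x i = (\<Sum>j\<in>J. of_int (a i j) * x j)"

definition bil :: "('i \<Rightarrow> real) \<Rightarrow> ('i \<Rightarrow> real) \<Rightarrow> real" where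
  "bil x y = (\<Sum>i\<in>J. e i * x i * co y i)"

definition simple_refl :: "'i \<Rightarrow> ('i \<Rightarrow> real) \<Rightarrow> 'i \<Rightarrow> real" where
  "simple_refl k x = (\<lambda>j. x j - (if j = k then co x k else 0))"

text \<open>Weyl group elements are words in simple reflections. The head of the list acts last, and
  reversing a word inverts it (\<open>act_rev\<close>).\<close>

definition act :: "'i list \<Rightarrow> ('i \<Rightarrow> real) \<Rightarrow> 'i \<Rightarrow> real" where
  "act = foldr simple_refl"

lemma act_simps [simp]: "act [] x = x" "act (k # ks) x = simple_refl k (act ks x)"
  by (simp_all add: act_def)

lemma act_append: "act (ks @ ks') x = act ks (act ks' x)"
  by (simp add: act_def)

lemma co_diff: "co (\<lambda>j. x j - y j) i = co x i - co y i"
  by (simp add: co_def sum_subtractf algebra_simps)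

lemma co_scale: "co (\<lambda>j. c * x j) i = c * co x i"
  by (simp add: co_def sum_distrib_left mult.left_commute)

lemma co_simple_refl:
  assumes "k \<in> J"
  shows "co (simple_refl k x) i = co x i - of_int (a i k) * co x k"
proof -
  have "(\<Sum>j\<in>J. of_int (a i j) * (if j = k then co x k else 0)) = of_int (a i k) * co x k"
    using assms by (simp add: if_distrib cong: if_cong)
  then show ?thesis
    unfolding simple_refl_def by (simp add: co_diff) (simp add: co_def)
qed

lemma bil_expand: "bil x y = (\<Sum>i\<in>J. \<Sum>j\<in>J. e i * of_int (a i j) * x i * y j)"
  by (simp add: bil_def co_def sum_distrib_left mult_ac)

lemma bil_commute: "bil x y = bil y x"
proof -
  have "bil x y = (\<Sum>j\<in>J. \<Sum>i\<in>J. e i * of_int (a i j) * x i * y j)"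
    unfolding bil_expand by (rule sum.swap)
  also have "\<dots> = bil y x"
    unfolding bil_expand by (intro sum.cong refl) (simp add: a_symm)
  finally show ?thesis .
qed

lemma bil_diff_left: "bil (\<lambda>j. x j - y j) z = bil x z - bil y z"
  by (simp add: bil_def sum_subtractf algebra_simps)

lemma bil_diff_right: "bil z (\<lambda>j. x j - y j) = bil z x - bil z y"
  by (simp add: bil_def co_diff sum_subtractf algebra_simps)

lemma bil_scale_left: "bil (\<lambda>j. c * x j) y = c * bil x y"
  by (simp add: bil_def sum_distrib_left mult_ac)

lemma bil_scale_right: "bil x (\<lambda>j. c * y j) = c * bil x y"
  by (simp add: bil_def co_scale sum_distrib_left mult_ac)

lemma bil_diff_square: "bil (\<lambda>j. x j - y j) (\<lambda>j. x j - y j) = bil x x - 2 * bil x y + bil y y"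
  by (simp add: bil_diff_left bil_diff_right bil_commute[of y x])

text \<open>The reflection subtracts a multiple \<open>u\<close> of the k-th simple root. Since the
  diagonal entry is 2, the square of \<open>u\<close> is twice its product with \<open>x\<close>,
  and the two corrections cancel.\<close>

lemma bil_simple_refl:
  assumes "k \<in> J"
  shows "bil (simple_refl k x) (simple_refl k x) = bil x x"
proof -
  define u where "u = (\<lambda>j. if j = k then co x k else 0)"
  have u: "bil u y = e k * co x k * co y k" for y
    using assms by (simp add: bil_def u_def if_distrib if_distribR cong: if_cong)
  have "co u k = of_int (a k k) * co x k"
    using assms by (simp add: co_def u_def if_distrib cong: if_cong)
  then have uu: "bil u u = 2 * bil u x"
    using assms by (simp add: u a_diag)
  have "simple_refl k x = (\<lambda>j. x j - u j)" by (simp add: simple_refl_def u_def)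
  then show ?thesis by (simp add: bil_diff_square uu bil_commute[of x u])
qed

lemma simple_refl_srefl:
  assumes "k \<in> J"
  shows "simple_refl k (simple_refl k x) = x"
proof -
  have "co (simple_refl k x) k = - co x k" using assms by (simp add: co_simple_refl a_diag)
  then show ?thesis by (auto simp: simple_refl_def[of k])
qed

lemma simple_refl_diff_scale: "simple_refl k (\<lambda>j. x j - c * y j) = (\<lambda>j. simple_refl k x j - c * simple_refl k y j)"
  by (auto simp: simple_refl_def co_diff co_scale algebra_simps)

lemma act_diff_scale: "act ks (\<lambda>j. x j - c * y j) = (\<lambda>j. act ks x j - c * act ks y j)"
  by (induction ks) (simp_all add: simple_refl_diff_scale)

lemma bil_act: "ks \<in> lists J \<Longrightarrow> bil (act ks x) (act ks x) = bil x x"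
  by (induction ks) (simp_all add: bil_simple_refl)

lemma act_rev: "ks \<in> lists J \<Longrightarrow> act (rev ks) (act ks x) = x"
  by (induction ks) (simp_all add: act_append simple_refl_srefl)

lemma co_simple_refl_Ints:
  assumes "k \<in> J" and "\<And>i. i \<in> J \<Longrightarrow> co x i \<in> \<int>" and "i \<in> J"
  shows "co (simple_refl k x) i \<in> \<int>"
  using assms by (simp add: co_simple_refl)

lemma co_act_Ints:
  assumes "ks \<in> lists J" and "\<And>i. i \<in> J \<Longrightarrow> co x i \<in> \<int>" and "i \<in> J"
  shows "co (act ks x) i \<in> \<int>"
  using assms(1,3) by (induction ks arbitrary: i) (simp_all add: assms(2) co_simple_refl_Ints)

text \<open>The positive vector \<open>v\<close> certifies semidefiniteness. Off the diagonal the
  entries of \<open>a\<close> are nonpositive, so a weighted AM-GM inequality bounds each mixed term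
  below by squares. These add up to multiples of the entries of \<open>a\<close> applied to
  \<open>v\<close>, which are nonnegative by \<open>a_v\<close>.\<close>

lemma bil_nonneg: "bil x x \<ge> 0"
proof -
  define t where "t i j = e i * of_int (a i j) * (x i)\<^sup>2 * v j / v i" for i j
  have amgm: "2 * (e i * of_int (a i j) * x i * x j) \<ge> t i j + t j i" if ij: "i \<in> J" "j \<in> J" for i j
  proof (cases "i = j")
    case True
    then show ?thesis using v_pos[OF ij(1)] by (simp add: t_def power2_eq_square)
  next
    case False
    have v: "v i > 0" "v j > 0" using v_pos ij by auto
    have "(e i * of_int (a i j)) * (x i * v j - x j * v i)\<^sup>2 \<le> 0"
      using a_offdiag[OF ij False] e_pos[OF ij(1)]
      by (intro mult_nonpos_nonneg mult_nonneg_nonpos) auto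
    then have "(e i * of_int (a i j)) * ((x i * v j)\<^sup>2 + (x j * v i)\<^sup>2)
        \<le> (e i * of_int (a i j)) * (2 * (x i * v j) * (x j * v i))"
      by (simp add: power2_diff algebra_simps)
    then have "(e i * of_int (a i j)) * ((x i * v j)\<^sup>2 + (x j * v i)\<^sup>2) / (v i * v j)
        \<le> (e i * of_int (a i j)) * (2 * (x i * v j) * (x j * v i)) / (v i * v j)"
      using v by (intro divide_right_mono) auto
    also have "(e i * of_int (a i j)) * ((x i * v j)\<^sup>2 + (x j * v i)\<^sup>2) / (v i * v j) = t i j + t j i"
      using v unfolding t_def a_symm[OF ij(2,1)]
      by (simp add: field_simps power2_eq_square)
    also have "(e i * of_int (a i j)) * (2 * (x i * v j) * (x j * v i)) / (v i * v j)
        = 2 * (e i * of_int (a i j) * x i * x j)"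
      using v by (simp add: field_simps)
    finally show ?thesis .
  qed
  have "0 \<le> (\<Sum>i\<in>J. e i * (x i)\<^sup>2 / v i * (\<Sum>j\<in>J. of_int (a i j) * v j))"
    using e_pos v_pos a_v
    by (intro sum_nonneg mult_nonneg_nonneg[OF _ a_v]) (auto simp: less_imp_le)
  also have "\<dots> = (\<Sum>i\<in>J. \<Sum>j\<in>J. t i j)"
    by (simp add: t_def sum_distrib_left sum_divide_distrib mult_ac)
  finally have nonneg: "0 \<le> (\<Sum>i\<in>J. \<Sum>j\<in>J. t i j)" .
  have "2 * (\<Sum>i\<in>J. \<Sum>j\<in>J. t i j) = (\<Sum>i\<in>J. \<Sum>j\<in>J. t i j + t j i)"
    using sum.swap[of t J J] by (simp add: sum.distrib)
  also have "\<dots> \<le> (\<Sum>i\<in>J. \<Sum>j\<in>J. 2 * (e i * of_int (a i j) * x i * x j))"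
    by (intro sum_mono amgm)
  also have "\<dots> = 2 * bil x x"
    by (simp add: bil_expand sum_distrib_left)
  finally show ?thesis using nonneg by simp
qed

text \<open>
  A point of the orbit that lies above \<open>x\<close> and has maximal height is dominant.  Heights are bounded on the
  orbit because the height is the scalar product with a fixed vector \<open>r\<close>.
\<close>

lemma ex_dominant_above:
  assumes int: "\<And>i. i \<in> J \<Longrightarrow> co x i \<in> \<int>"
  shows "\<exists>ks\<in>lists J. (\<forall>i\<in>J. 0 \<le> co (act ks x) i) \<and> (\<forall>i\<in>J. x i \<le> act ks x i)"
proof -
  define S where "S = {ks \<in> lists J. (\<forall>i\<in>J. x i \<le> act ks x i)}"
  define ht where "ht y = (\<Sum>i\<in>J. y i)" for y :: "'i \<Rightarrow> real"
  \<comment> \<open>The values \<open>1 / e i\<close> make every simple root have scalar product 1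
    with \<open>r\<close>.\<close>
  obtain r where r: "\<forall>i\<in>J. (\<Sum>j\<in>J. of_int (a i j) * r j) = 1 / e i"
    using a_surj[of "\<lambda>i. 1 / e i"] by blast
  have ht_bil: "ht y = bil y r" for y
    using r e_pos unfolding ht_def bil_def co_def
    by (intro sum.cong refl) (fastforce simp: less_imp_neq)
  have bound: "- ((bil x x + bil r r) / 2) \<le> - ht (act ks x)" if "ks \<in> S" for ks
  proof -
    \<comment> \<open>The squared distance to \<open>r\<close> is nonnegative and the norm is
      constant on the orbit, which bounds the height from above.\<close>
    have "0 \<le> bil (act ks x) (act ks x) - 2 * bil (act ks x) r + bil r r"
      using bil_nonneg[of "\<lambda>j. act ks x j - r j"] by (simp add: bil_diff_square)
    then show ?thesis using that by (simp add: S_def ht_bil bil_act)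
  qed
  \<comment> \<open>Integral coroot values persist along the orbit, so each reflection moves by an
    integral multiple of a simple root; heights stay in one coset of the integers.\<close>
  have diff: "act ks x i - x i \<in> \<int>" if "ks \<in> lists J" for ks i
    using that
  proof (induction ks)
    case (Cons k ks)
    have "co (act ks x) k \<in> \<int>" using Cons int by (intro co_act_Ints) auto
    moreover have "act (k # ks) x i - x i = (act ks x i - x i) - (if i = k then co (act ks x) k else 0)"
      by (simp add: simple_refl_def)
    ultimately show ?case using Cons by (simp only:) (auto intro!: Ints_diff)
  qed simp
  have "1 * (- ht (act ks x) - (- ht x)) \<in> \<int>" if "ks \<in> S" for ks
  proof -
    have "- ht (act ks x) - (- ht x) = - (\<Sum>i\<in>J. act ks x i - x i)"
      by (simp add: ht_def sum_subtractf)
    then show ?thesis using that diff by (simp only: mult_1) (auto simp: S_def intro!: Ints_sum)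
  qed
  moreover have "[] \<in> S" by (simp add: S_def)
  ultimately obtain ks where ks: "ks \<in> S" "\<forall>ks'\<in>S. - ht (act ks x) \<le> - ht (act ks' x)"
    using discrete_bounded_below_attains_min[of S 1 _ "\<lambda>ks. - ht (act ks x)" "- ht x"] bound
    by (metis empty_iff zero_less_one)
  have "0 \<le> co (act ks x) k" if "k \<in> J" for k
  proof (rule ccontr)
    assume neg: "\<not> 0 \<le> co (act ks x) k"
    \<comment> \<open>Reflecting at a negative coroot value raises coordinate \<open>k\<close> and
      no other, so the new point still lies above \<open>x\<close> but is higher.\<close>
    have "k # ks \<in> S"
      using ks(1) that neg by (fastforce simp: S_def simple_refl_def)
    then have "ht (act (k # ks) x) \<le> ht (act ks x)" using ks(2) by fastforce
    moreover have "ht (act (k # ks) x) = ht (act ks x) - co (act ks x) k"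
      using that by (simp add: ht_def simple_refl_def sum_subtractf)
    ultimately show False using neg by simp
  qed
  then show ?thesis using ks(1) by (auto simp: S_def)
qed

text \<open>The combinatorial core, in root coordinates: \<open>q\<close> stands for \<lambda> and
  \<gamma> for \<theta> divided by the label of vertex 0. \<open>N\<close> and \<open>K\<close>
  bound the denominators of the coordinates in \<open>M\<close> and of the form. The last inequality
  is the affine wall of the alcove at level \<open>l\<close>.\<close>

lemma ex_translate_in_alcove:
  fixes M :: "('i \<Rightarrow> real) set" and N :: nat and K :: real and l :: nat
  assumes M_zero: "(\<lambda>_. 0) \<in> M"
    and M_diff: "\<And>x y. x \<in> M \<Longrightarrow> y \<in> M \<Longrightarrow> (\<lambda>j. x j - y j) \<in> M"
    and M_simple_refl: "\<And>x k. x \<in> M \<Longrightarrow> k \<in> J \<Longrightarrow> simple_refl k x \<in> M"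
    and M_co: "\<And>x i. x \<in> M \<Longrightarrow> i \<in> J \<Longrightarrow> co x i \<in> \<int>"
    and M_denom: "\<And>x i. x \<in> M \<Longrightarrow> i \<in> J \<Longrightarrow> real N * x i \<in> \<int>" and "N > 0"
    and K: "K > 0" "\<And>i. i \<in> J \<Longrightarrow> K * e i \<in> \<int>"
    and "l > 0" and "\<gamma> \<in> M"
    and q_int: "\<And>i. i \<in> J \<Longrightarrow> co q i \<in> \<int>"
    and q_dom: "\<And>i. i \<in> J \<Longrightarrow> 0 \<le> co q i"
  shows "\<exists>\<mu>\<in>M. \<exists>ks\<in>lists J. \<exists>x. x = act ks (\<lambda>j. real l * \<mu> j - q j) \<and> (\<forall>i\<in>J. 0 \<le> co \<mu> i) \<and>
    (\<forall>i\<in>J. 0 \<le> co x i) \<and> (\<forall>i\<in>J. co x i \<in> \<int>) \<and> 2 * bil x \<gamma> \<le> real l * bil \<gamma> \<gamma>"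
proof -
  define F where "F \<mu> = bil (\<lambda>j. real l * \<mu> j - q j) (\<lambda>j. real l * \<mu> j - q j)" for \<mu>
  have F: "F \<mu> = (real l)\<^sup>2 * bil \<mu> \<mu> - 2 * real l * bil \<mu> q + bil q q" for \<mu>
    by (simp add: F_def bil_diff_square bil_scale_left bil_scale_right power2_eq_square)
  \<comment> \<open>\<open>K\<close> clears the denominators of the \<open>e i\<close> and
    \<open>N\<close> those of the coordinates, while the coroot values of the second argument are
    integers.\<close>
  have NK: "real N * K * bil \<mu> y \<in> \<int>" if "\<mu> \<in> M" "\<And>i. i \<in> J \<Longrightarrow> co y i \<in> \<int>" for \<mu> y
  proof -
    have "real N * K * bil \<mu> y = (\<Sum>i\<in>J. (K * e i) * (real N * \<mu> i) * co y i)"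
      by (simp add: bil_def sum_distrib_left mult_ac)
    then show ?thesis
      using that K M_denom by (simp only:) (blast intro: Ints_sum Ints_mult)
  qed
  \<comment> \<open>The constant \<open>bil q q\<close> is split off because the scaling need not
    make it integral: \<open>N\<close> controls coordinates in \<open>M\<close>, not those of
    \<open>q\<close>.\<close>
  have "real N * K * (F \<mu> - bil q q) \<in> \<int>" if "\<mu> \<in> M" for \<mu>
  proof -
    have "real N * K * (F \<mu> - bil q q)
        = of_nat (l\<^sup>2) * (real N * K * bil \<mu> \<mu>) - of_nat (2 * l) * (real N * K * bil \<mu> q)"
      by (simp add: F algebra_simps)
    moreover have "real N * K * bil \<mu> \<mu> \<in> \<int>" "real N * K * bil \<mu> q \<in> \<int>"
      using NK that M_co q_int by auto
    ultimately show ?thesis by (simp only:) (intro Ints_diff Ints_mult[OF Ints_of_nat])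
  qed
  moreover have "0 \<le> F \<mu>" for \<mu> by (simp add: F_def bil_nonneg)
  moreover have "real N * K > 0" using \<open>N > 0\<close> K by simp
  ultimately obtain \<mu>0 where \<mu>0: "\<mu>0 \<in> M" "\<And>\<mu>. \<mu> \<in> M \<Longrightarrow> F \<mu>0 \<le> F \<mu>"
    using discrete_bounded_below_attains_min[of M "real N * K" 0 F "bil q q"] M_zero by blast
  obtain ks where ks: "ks \<in> lists J" "\<forall>i\<in>J. 0 \<le> co (act ks \<mu>0) i" "\<forall>i\<in>J. \<mu>0 i \<le> act ks \<mu>0 i"
    using ex_dominant_above[of \<mu>0] M_co \<mu>0(1) by blast
  have M_act: "act vs y \<in> M" if "vs \<in> lists J" "y \<in> M" for vs y
    using that by (induction vs) (auto intro: M_simple_refl)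
  define \<mu> where "\<mu> = act ks \<mu>0"
  have \<mu>: "\<mu> \<in> M" using M_act ks(1) \<mu>0(1) by (simp add: \<mu>_def)
  \<comment> \<open>The dominant conjugate has larger coordinates and the coroot values of
    \<open>q\<close> are nonnegative. The norm is unchanged, so \<open>F\<close> cannot
    grow.\<close>
  have "bil \<mu>0 q \<le> bil \<mu> q"
    unfolding bil_def \<mu>_def using ks(3) q_dom e_pos
    by (intro sum_mono mult_right_mono mult_left_mono) (auto intro: less_imp_le)
  then have "F \<mu> \<le> F \<mu>0"
    using ks(1) by (simp add: F \<mu>_def bil_act mult_left_mono)
  then have min: "F \<mu> \<le> F \<mu>'" if "\<mu>' \<in> M" for \<mu>'
    using \<mu>0(2)[OF that] by simp
  define y where "y = (\<lambda>j. real l * \<mu> j - q j)"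
  have y_int: "co y i \<in> \<int>" if "i \<in> J" for i
    using M_co[OF \<mu> that] q_int[OF that] by (simp add: y_def co_diff co_scale)
  obtain vs where vs: "vs \<in> lists J" "\<forall>i\<in>J. 0 \<le> co (act vs y) i"
    using ex_dominant_above[of y] y_int by blast
  define x where "x = act vs y"
  define \<gamma>' where "\<gamma>' = act (rev vs) \<gamma>"
  have rvs: "rev vs \<in> lists J" using vs(1) by auto
  have "\<gamma>' \<in> M" unfolding \<gamma>'_def using rvs \<open>\<gamma> \<in> M\<close> by (rule M_act)
  then have "F \<mu> \<le> F (\<lambda>j. \<mu> j - \<gamma>' j)" using M_diff \<mu> min by blast
  also have "F (\<lambda>j. \<mu> j - \<gamma>' j) = bil (\<lambda>j. y j - real l * \<gamma>' j) (\<lambda>j. y j - real l * \<gamma>' j)"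
    by (simp add: F_def y_def algebra_simps)
  \<comment> \<open>The word \<open>rev vs\<close> carries \<gamma> to \<open>\<gamma>'\<close>, so
    the competitor is conjugate to \<open>x\<close> shifted by \<gamma> itself and has the same
    norm.\<close>
  also have "(\<lambda>j. y j - real l * \<gamma>' j) = act (rev vs) (\<lambda>j. x j - real l * \<gamma> j)"
    by (simp add: act_diff_scale x_def \<gamma>'_def act_rev vs(1))
  also have "bil \<dots> \<dots> = bil (\<lambda>j. x j - real l * \<gamma> j) (\<lambda>j. x j - real l * \<gamma> j)"
    using rvs by (rule bil_act)
  also have "\<dots> = bil x x - 2 * real l * bil x \<gamma> + (real l)\<^sup>2 * bil \<gamma> \<gamma>"
    by (simp add: bil_diff_square bil_scale_left bil_scale_right power2_eq_square)
  also have "F \<mu> = bil x x" using vs(1) by (simp add: F_def x_def y_def bil_act)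
  finally have "real l * (2 * bil x \<gamma>) \<le> real l * (real l * bil \<gamma> \<gamma>)"
    by (simp add: power2_eq_square algebra_simps)
  then have "2 * bil x \<gamma> \<le> real l * bil \<gamma> \<gamma>" using \<open>l > 0\<close> by simp
  moreover have "\<forall>i\<in>J. co x i \<in> \<int>" unfolding x_def using co_act_Ints vs(1) y_int by blast
  ultimately show ?thesis
    using \<mu> vs ks(2) unfolding x_def y_def \<mu>_def[symmetric] by blast
qed

end


section \<open>The labels of the affine diagrams\<close>

lemma path_edges_iff [simp]: "(i, j) \<in> path_edges k l \<longleftrightarrow> j = Suc i \<and> k \<le> i \<and> i < l"
  by (auto simp: path_edges_def)

lemma cartan_matrix_diag: "cartan_matrix X i i = 2"
  by (simp add: cartan_matrix_def)

lemma cartan_matrix_offdiag: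
  assumes "i \<noteq> j"
  shows "cartan_matrix X i j \<le> 0"
proof -
  have "lines X i j \<ge> 0" by (cases "(X, i, j)" rule: lines.cases) simp_all
  then show ?thesis using assms by (simp add: cartan_matrix_def)
qed

lemma comark_0: "comark X 0 = 1"
  by (cases X) auto

lemma mark_pos: "i \<le> aff_rank X \<Longrightarrow> mark X i > 0"
  by (cases X) (auto simp: numeral_eq_Suc le_Suc_eq)

lemma comark_pos: "i \<le> aff_rank X \<Longrightarrow> comark X i > 0"
  by (cases X) (auto simp: numeral_eq_Suc le_Suc_eq)

text \<open>Vanishing for all \<open>j\<close> says that the \<open>comark\<close> labels form a
  left null vector. Only this relation is checked against the tables; the row relation for
  \<open>mark\<close> is deduced from it in \<open>GCM_row\<close>.\<close>

definition column_sum :: "affine_type \<Rightarrow> nat \<Rightarrow> int" where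
  "column_sum X j = (\<Sum>i\<le>aff_rank X. int (comark X i) * cartan_matrix X i j)"

text \<open>A column is supported on a vertex and its neighbours, so a sum of length depending on
  \<open>n\<close> reduces to a few explicit terms.\<close>

lemma column_sumI:
  assumes "S \<subseteq> {..aff_rank X}"
    and "\<And>i. i \<le> aff_rank X \<Longrightarrow> i \<notin> S \<Longrightarrow> cartan_matrix X i j = 0"
    and "(\<Sum>i\<in>S. int (comark X i) * cartan_matrix X i j) = 0"
  shows "column_sum X j = 0"
proof -
  have "column_sum X j = (\<Sum>i\<in>S. int (comark X i) * cartan_matrix X i j)"
    unfolding column_sum_def using assms(1,2) by (intro sum.mono_neutral_right) auto
  then show ?thesis using assms(3) by simp
qed

lemma column_sum_AffA:
  assumes "n \<ge> 1" and "j \<le> n"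
  shows "column_sum (AffA n) j = 0"
proof -
  \<comment> \<open>For \<open>n = 1\<close> the cycle collapses to two vertices with both entries
    -2. Otherwise vertices 0 and \<open>n\<close> are neighbours through the closing edge.\<close>
  consider "n = 1" | "n \<ge> 2" "j = 0" | k where "n \<ge> 2" "j = Suc k" "j < n" | k where "j = Suc k" "j = n" "k \<ge> 1"
    using assms by (cases j) force+
  then show ?thesis
  proof cases
    case 1
    then show ?thesis using assms
      by (auto simp: column_sum_def cartan_matrix_def le_Suc_eq)
  next
    case 2
    then show ?thesis
      by (intro column_sumI[of "{0, 1, n}"]) (auto simp: cartan_matrix_def)
  next
    case 3
    then show ?thesis
      by (intro column_sumI[of "{k, Suc k, Suc (Suc k)}"]) (auto simp: cartan_matrix_def)
  next
    case 4
    then show ?thesis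
      by (intro column_sumI[of "{0, k, n}"]) (auto simp: cartan_matrix_def)
  qed
qed

text \<open>All three diagrams are paths whose special entries sit at the two ends;
  \<open>n \<ge> 2\<close> keeps the end edges distinct.\<close>

lemma column_sum_linear:
  assumes "n \<ge> 2" and "j \<le> n" and "X \<in> {AffC n, TwA_even n, TwD n}"
  shows "column_sum X j = 0"
proof -
  consider "j = 0" | k where "j = Suc k" "j < n" | k where "j = Suc k" "j = n" "k \<ge> 1"
    using assms by (cases j) force+
  then show ?thesis
  proof cases
    case 1
    then show ?thesis using assms
      by (intro column_sumI[of "{0, 1}"]) (auto simp: cartan_matrix_def)
  next
    case 2
    then show ?thesis using assms
      by (intro column_sumI[of "{k, Suc k, Suc (Suc k)}"]) (auto simp: cartan_matrix_def)
  next
    case 3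
    then show ?thesis using assms
      by (intro column_sumI[of "{k, n}"]) (auto simp: cartan_matrix_def)
  qed
qed

lemma column_sum_fork:
  assumes "n \<ge> 3" and "j \<le> n" and "X \<in> {AffB n, TwA_odd n}"
  shows "column_sum X j = 0"
proof -
  \<comment> \<open>Vertices 0 and 1 are both leaves attached to vertex 2, the only vertex with
    three neighbours.\<close>
  consider "j = 0" | "j = 1" | "j = 2" | k where "j = Suc k" "j < n" "k \<ge> 2" | k where "j = Suc k" "j = n" "k \<ge> 2"
    using assms by (cases j) force+
  then show ?thesis
  proof cases
    case 1
    then show ?thesis using assms
      by (intro column_sumI[of "{0, 2}"]) (auto simp: cartan_matrix_def)
  next
    case 2
    then show ?thesis using assms
      by (intro column_sumI[of "{1, 2}"]) (auto simp: cartan_matrix_def)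
  next
    case 3
    then show ?thesis using assms
      by (intro column_sumI[of "{0, 1, 2, 3}"]) (auto simp: cartan_matrix_def)
  next
    case 4
    then show ?thesis using assms
      by (intro column_sumI[of "{k, Suc k, Suc (Suc k)}"]) (auto simp: cartan_matrix_def)
  next
    case 5
    then show ?thesis using assms
      by (intro column_sumI[of "{k, n}"]) (auto simp: cartan_matrix_def)
  qed
qed

lemma column_sum_AffD:
  assumes "n \<ge> 4" and "j \<le> n"
  shows "column_sum (AffD n) j = 0"
proof -
  \<comment> \<open>For \<open>n = 4\<close> the two forks share vertex 2. Otherwise the second one
    sits at \<open>n - 2\<close>, written \<open>m + 1\<close>, with leaves \<open>m + 2\<close> and
    \<open>m + 3\<close>.\<close>
  consider "n = 4" | "j = 0" | "j = 1" | "j = 2" "n \<ge> 5" | k where "j = Suc k" "2 \<le> k" "k + 3 < n"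
    | m where "n = m + 3" "j = m + 1" "2 \<le> m" | "j = n - 1" | "j = n"
    using assms by (cases j) force+
  then show ?thesis
  proof cases
    case 1
    then show ?thesis using assms
      by (auto simp: column_sum_def cartan_matrix_def numeral_eq_Suc le_Suc_eq)
  next
    case 2
    then show ?thesis using assms
      by (intro column_sumI[of "{0, 2}"]) (auto simp: cartan_matrix_def)
  next
    case 3
    then show ?thesis using assms
      by (intro column_sumI[of "{1, 2}"]) (auto simp: cartan_matrix_def)
  next
    case 4
    then show ?thesis using assms
      by (intro column_sumI[of "{0, 1, 2, 3}"]) (auto simp: cartan_matrix_def)
  next
    case 5
    then show ?thesis using assms
      by (intro column_sumI[of "{k, Suc k, Suc (Suc k)}"]) (auto simp: cartan_matrix_def)
  next
    case 6
    then show ?thesis using assms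
      by (intro column_sumI[of "{m, m + 1, m + 2, m + 3}"]) (auto simp: cartan_matrix_def)
  next
    case 7
    then show ?thesis using assms
      by (intro column_sumI[of "{n - 2, n - 1}"]) (auto simp: cartan_matrix_def)
  next
    case 8
    then show ?thesis using assms
      by (intro column_sumI[of "{n - 2, n}"]) (auto simp: cartan_matrix_def)
  qed
qed

lemma column_sum_eq_0:
  assumes "in_tables X" and "j \<le> aff_rank X"
  shows "column_sum X j = 0"
proof -
  consider n where "X \<in> {AffC n, TwA_even n, TwD n}" "n \<ge> 2"
    | n where "X = AffA n" | n where "X \<in> {AffB n, TwA_odd n}" | n where "X = AffD n"
    | "X = TwA_even 1" | "X \<in> {AffE6, AffE7, AffE8, AffF4, AffG2, TwE6, TwD4}"
    using assms(1) by (cases X) force+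
  then show ?thesis
  proof cases
    case 1
    then show ?thesis using assms column_sum_linear by auto
  next
    case 2
    then show ?thesis using assms column_sum_AffA by auto
  next
    case 3
    then show ?thesis using assms column_sum_fork by auto
  next
    case 4
    then show ?thesis using assms column_sum_AffD by auto
  next
    case 5
    then show ?thesis using assms
      by (auto simp: column_sum_def cartan_matrix_def le_Suc_eq)
  next
    case 6
    then show ?thesis using assms
      by (elim insertE) (auto simp: column_sum_def numeral_eq_Suc le_Suc_eq cartan_matrix_def)
  qed
qed


section \<open>The Cartan subalgebra and its dual\<close>

context vector_space
begin

text \<open>If two indices gave the same vector, coefficients 1 and -1 there would form a nontrivial
  relation. Injectivity then lets sums over the image be reindexed by \<open>I\<close>.\<close>

lemma independent_family:
  assumes "finite I"
    and zero: "\<And>k i. (\<Sum>i\<in>I. scale (k i) (f i)) = 0 \<Longrightarrow> i \<in> I \<Longrightarrow> k i = 0"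
  shows "inj_on f I" and "independent (f ` I)"
proof -
  show inj: "inj_on f I"
  proof (rule inj_onI, rule ccontr)
    fix i j assume ij: "i \<in> I" "j \<in> I" "f i = f j" "i \<noteq> j"
    define k :: "_ \<Rightarrow> 'a" where "k x = (if x = i then 1 else 0) - (if x = j then 1 else 0)" for x
    have "(\<Sum>x\<in>I. scale (k x) (f x)) = (\<Sum>x\<in>I. if x = i then f x else 0) - (\<Sum>x\<in>I. if x = j then f x else 0)"
      unfolding sum_subtractf[symmetric] by (intro sum.cong) (auto simp: k_def scale_left_diff_distrib)
    also have "\<dots> = 0" using ij \<open>finite I\<close> by simp
    finally have "k i = 0" using ij(1) by (rule zero)
    then show False using ij(4) by (simp add: k_def)
  qed
  show "independent (f ` I)"
  proof (rule independent_if_scalars_zero)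
    fix k x assume "(\<Sum>x\<in>f ` I. scale (k x) x) = 0" "x \<in> f ` I"
    then show "k x = 0" using zero[of "k \<circ> f"] by (auto simp: sum.reindex[OF inj])
  qed (use assms(1) in simp)
qed

lemma span_family:
  assumes "finite I" and "inj_on f I" and "x \<in> span (f ` I)"
  shows "\<exists>k. x = (\<Sum>i\<in>I. scale (k i) (f i))"
proof -
  obtain u where "x = (\<Sum>v\<in>f ` I. scale (u v) v)"
    using assms(3) span_finite[of "f ` I"] assms(1) by auto
  then show ?thesis by (auto simp: sum.reindex[OF assms(2)])
qed

text \<open>A vector of \<open>V\<close> outside the span of \<open>S\<close> would enlarge
  \<open>S\<close> to an independent set with more elements than the spanning set
  \<open>T\<close>.\<close>

lemma independent_spans:
  assumes "finite T" and "V \<subseteq> span T" and "card T \<le> card S"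
    and "independent S" and "finite S" and "S \<subseteq> V"
  shows "V \<subseteq> span S"
proof (rule ccontr)
  assume "\<not> V \<subseteq> span S"
  then obtain x where x: "x \<in> V" "x \<notin> span S" by blast
  then have "independent (insert x S)" "x \<notin> S"
    using independent_insertI[OF x(2) assms(4)] span_base by blast+
  then have "card (insert x S) \<le> card T"
    using independent_span_bound[OF assms(1)] assms(2,6) x(1) by blast
  then show False using \<open>x \<notin> S\<close> assms(3,5) by simp
qed

end

section \<open>Relations between labels, Cartan matrix and invariant form\<close>

locale affine_lie =
  fixes \<gg> :: "'g::ab_group_add affine_data"
  assumes affine: "affine_lie_algebra \<gg>"
begin

sublocale vector_space "smult \<gg>"
  using affine by (simp add: affine_lie_algebra_def kac_moody_def lie_algebra_def)

definition J :: "nat set" where "J = {1..rk \<gg>}"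

lemma in_J [simp]: "i \<in> J \<longleftrightarrow> 1 \<le> i \<and> i \<le> rk \<gg>"
  by (simp add: J_def)

lemma finite_simple_roots [simp]: "finite J"
  by (simp add: J_def)

lemma sum_atMost_split: "(\<Sum>i\<le>rk \<gg>. f i) = f 0 + (\<Sum>i\<in>J. f i)" for f :: "nat \<Rightarrow> 'a::comm_monoid_add"
  by (simp add: J_def atMost_atLeast0 sum.atLeast_Suc_atMost)

abbreviation \<a> :: "nat \<Rightarrow> nat" where "\<a> \<equiv> mark (dynkin \<gg>)"
abbreviation \<c> :: "nat \<Rightarrow> nat" where "\<c> \<equiv> comark (dynkin \<gg>)"

lemma realization: "realization \<gg>"
  using affine by (simp add: affine_lie_algebra_def kac_moody_def)

lemma normalized_form: "normalized_invariant_form \<gg>"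
  using affine by (simp add: affine_lie_algebra_def)

lemma cartan_subspace: "subspace (cartan \<gg>)"
  using realization by (simp add: realization_def)

lemma coroot_cartan [simp]: "i \<le> rk \<gg> \<Longrightarrow> coroot \<gg> i \<in> cartan \<gg>"
  using realization by (simp add: realization_def)

lemma root_dual [simp]: "i \<le> rk \<gg> \<Longrightarrow> root \<gg> i \<in> dual \<gg>"
  using realization by (simp add: realization_def)

lemma root_coroot: "i \<le> rk \<gg> \<Longrightarrow> j \<le> rk \<gg> \<Longrightarrow> root \<gg> j (coroot \<gg> i) = of_int (GCM \<gg> i j)"
  using realization by (simp add: realization_def)

lemma coroot_independent:
  "(\<Sum>i\<le>rk \<gg>. smult \<gg> (k i) (coroot \<gg> i)) = 0 \<Longrightarrow> i \<le> rk \<gg> \<Longrightarrow> k i = 0"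
  using realization by (simp add: realization_def)

lemma root_independent:
  "(\<And>x. (\<Sum>i\<le>rk \<gg>. k i * root \<gg> i x) = 0) \<Longrightarrow> i \<le> rk \<gg> \<Longrightarrow> k i = 0"
  using realization by (simp add: realization_def)

lemma scaling_cartan [simp]: "scaling \<gg> \<in> cartan \<gg>"
  using affine by (simp add: affine_lie_algebra_def scaling_element_def)

lemma root_scaling: "i \<le> rk \<gg> \<Longrightarrow> root \<gg> i (scaling \<gg>) = (if i = 0 then 1 else 0)"
  using affine by (simp add: affine_lie_algebra_def scaling_element_def)

lemma form_commute: "form \<gg> x y = form \<gg> y x"
  using normalized_form unfolding normalized_invariant_form_def by blast

lemma form_sum:
  "form \<gg> x (\<Sum>i\<in>I. smult \<gg> (k i) (y i)) = (\<Sum>i\<in>I. k i * form \<gg> x (y i))"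
proof -
  have "Vector_Spaces.linear (smult \<gg>) (*) (form \<gg> x)"
    using normalized_form unfolding normalized_invariant_form_def by blast
  then have "module_hom (smult \<gg>) (*) (form \<gg> x)"
    by (rule Vector_Spaces.linear.axioms(3))
  then show ?thesis by (simp add: module_hom.sum module_hom.scale)
qed

lemma form_coroot:
  "i \<le> rk \<gg> \<Longrightarrow> j \<le> rk \<gg> \<Longrightarrow>
    form \<gg> (coroot \<gg> i) (coroot \<gg> j) = of_nat (\<a> j) / of_nat (\<c> j) * of_int (GCM \<gg> i j)"
  using normalized_form unfolding normalized_invariant_form_def by blast

lemma form_scaling:
  "i \<le> rk \<gg> \<Longrightarrow> form \<gg> (scaling \<gg>) (coroot \<gg> i) = (if i = 0 then of_nat (\<a> 0) else 0)"
  using normalized_form unfolding normalized_invariant_form_def by (metis form_commute)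

lemma marks_pos: "i \<le> rk \<gg> \<Longrightarrow> \<a> i > 0" "i \<le> rk \<gg> \<Longrightarrow> \<c> i > 0"
  by (simp_all add: mark_pos comark_pos)

lemma GCM_column: "j \<le> rk \<gg> \<Longrightarrow> (\<Sum>i\<le>rk \<gg>. int (\<c> i) * GCM \<gg> i j) = 0"
  using column_sum_eq_0 affine by (simp add: column_sum_def affine_lie_algebra_def)

text \<open>This is the symmetry of the invariant form on pairs of coroots, read off over the reals;
  no inspection of the tables is involved.\<close>

lemma GCM_symm:
  assumes "i \<le> rk \<gg>" and "j \<le> rk \<gg>"
  shows "real (\<c> i) / real (\<a> i) * GCM \<gg> i j = real (\<c> j) / real (\<a> j) * GCM \<gg> j i"
proof -
  have "of_nat (\<a> j) / of_nat (\<c> j) * of_int (GCM \<gg> i j)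
      = (of_nat (\<a> i) / of_nat (\<c> i) * of_int (GCM \<gg> j i) :: complex)"
    using assms form_coroot form_commute by metis
  then have "complex_of_real (real (\<a> j) / real (\<c> j) * GCM \<gg> i j)
      = complex_of_real (real (\<a> i) / real (\<c> i) * GCM \<gg> j i)"
    by simp
  then have "real (\<a> j) / real (\<c> j) * GCM \<gg> i j = real (\<a> i) / real (\<c> i) * GCM \<gg> j i"
    by (simp only: of_real_eq_iff)
  then show ?thesis
    using marks_pos[OF assms(1)] marks_pos[OF assms(2)] by (simp add: field_simps)
qed

text \<open>The symmetrizer turns the terms of row \<open>i\<close> into those of column
  \<open>i\<close>, up to the nonzero factor \<open>\<c> i / \<a> i\<close>.\<close>

lemma GCM_row:
  assumes "i \<le> rk \<gg>"
  shows "(\<Sum>j\<le>rk \<gg>. GCM \<gg> i j * int (\<a> j)) = 0"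
proof -
  have "real (\<c> i) / real (\<a> i) * (GCM \<gg> i j * real (\<a> j)) = \<c> j * GCM \<gg> j i" if "j \<le> rk \<gg>" for j
    using GCM_symm[OF assms that] marks_pos[OF that] by (simp add: field_simps)
  then have "real (\<c> i) / real (\<a> i) * (\<Sum>j\<le>rk \<gg>. GCM \<gg> i j * real (\<a> j))
      = real_of_int (\<Sum>j\<le>rk \<gg>. int (\<c> j) * GCM \<gg> j i)"
    by (simp add: sum_distrib_left)
  also have "\<dots> = 0" using GCM_column[OF assms] by (simp only: of_int_0)
  finally have "real_of_int (\<Sum>j\<le>rk \<gg>. GCM \<gg> i j * int (\<a> j)) = 0"
    using marks_pos[OF assms] by simp
  then show ?thesis by (simp only: of_int_eq_0_iff)
qed

lemma dual_sum:
  assumes "\<Lambda> \<in> dual \<gg>" and "finite I" and "\<And>i. i \<in> I \<Longrightarrow> y i \<in> cartan \<gg>"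
  shows "\<Lambda> (\<Sum>i\<in>I. smult \<gg> (k i) (y i)) = (\<Sum>i\<in>I. k i * \<Lambda> (y i))"
  using assms(2,3)
proof (induction I)
  case empty
  have "\<Lambda> (smult \<gg> 0 0) = 0 * \<Lambda> 0"
    using assms(1) subspace_0[OF cartan_subspace] unfolding dual_def by blast
  then show ?case by simp
next
  case (insert i I)
  have "smult \<gg> (k i) (y i) \<in> cartan \<gg>" "(\<Sum>i\<in>I. smult \<gg> (k i) (y i)) \<in> cartan \<gg>"
    using insert.prems cartan_subspace by (auto intro!: subspace_sum subspace_scale)
  then show ?case using insert assms(1) by (simp add: dual_def)
qed

lemma dual_central:
  assumes "\<Lambda> \<in> dual \<gg>"
  shows "\<Lambda> (central \<gg>) = \<Lambda> (coroot \<gg> 0) + (\<Sum>i\<in>J. of_nat (\<c> i) * \<Lambda> (coroot \<gg> i))"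
proof -
  have "\<Lambda> (central \<gg>) = (\<Sum>i\<le>rk \<gg>. of_nat (\<c> i) * \<Lambda> (coroot \<gg> i))"
    unfolding central_def by (rule dual_sum[OF assms]) auto
  then show ?thesis by (simp add: sum_atMost_split comark_0)
qed

lemma root_central:
  assumes "j \<le> rk \<gg>"
  shows "root \<gg> j (central \<gg>) = 0"
proof -
  have "root \<gg> j (central \<gg>) = (\<Sum>i\<le>rk \<gg>. of_nat (\<c> i) * root \<gg> j (coroot \<gg> i))"
    unfolding central_def by (rule dual_sum[OF root_dual[OF assms]]) auto
  also have "\<dots> = (\<Sum>i\<le>rk \<gg>. of_nat (\<c> i) * of_int (GCM \<gg> i j))"
    using assms by (simp add: root_coroot)
  also have "\<dots> = of_int (\<Sum>i\<le>rk \<gg>. int (\<c> i) * GCM \<gg> i j)" by simp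
  finally show ?thesis using GCM_column[OF assms] by simp
qed

section \<open>A basis of the Cartan subalgebra and functionals determined by it\<close>

definition cartan_basis :: "nat \<Rightarrow> 'g" where
  "cartan_basis i = (if i \<le> rk \<gg> then coroot \<gg> i else scaling \<gg>)"

text \<open>The scaling element is not a combination of coroots: \<open>c\<close> is orthogonal to all of them, but not to it.\<close>

lemma cartan_basis:
  shows inj_cartan_basis: "inj_on cartan_basis {..Suc (rk \<gg>)}"
    and independent_cartan_basis: "independent (cartan_basis ` {..Suc (rk \<gg>)})"
    and cartan_span: "cartan \<gg> \<subseteq> span (cartan_basis ` {..Suc (rk \<gg>)})"
proof -
  have zero: "k i = 0" if sum: "(\<Sum>i\<le>Suc (rk \<gg>). smult \<gg> (k i) (cartan_basis i)) = 0"
    and "i \<in> {..Suc (rk \<gg>)}" for k i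
  proof -
    have coroot_c: "form \<gg> (central \<gg>) (coroot \<gg> j) = 0" if "j \<le> rk \<gg>" for j
    proof -
      have "form \<gg> (coroot \<gg> j) (central \<gg>)
          = (\<Sum>i\<le>rk \<gg>. of_nat (\<c> i) * form \<gg> (coroot \<gg> i) (coroot \<gg> j))"
        unfolding central_def form_sum using form_commute by simp
      also have "\<dots> = of_nat (\<a> j) / of_nat (\<c> j) * of_int (\<Sum>i\<le>rk \<gg>. int (\<c> i) * GCM \<gg> i j)"
        using that by (simp add: form_coroot sum_distrib_left mult_ac)
      finally show ?thesis using GCM_column[OF that] form_commute by simp
    qed
    have "form \<gg> (scaling \<gg>) (central \<gg>) = of_nat (\<a> 0)"
      unfolding central_def form_sum by (simp add: form_scaling sum_atMost_split comark_0)
    then have "k (Suc (rk \<gg>)) * of_nat (\<a> 0)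
        = form \<gg> (central \<gg>) (\<Sum>i\<le>Suc (rk \<gg>). smult \<gg> (k i) (cartan_basis i))"
      unfolding form_sum by (simp add: cartan_basis_def coroot_c form_commute)
    \<comment> \<open>Zero is written as an empty combination, so that \<open>form_sum\<close>
      evaluates the form there.\<close>
    also have "\<dots> = form \<gg> (central \<gg>) (\<Sum>i\<in>{}. smult \<gg> (k i) (cartan_basis i))"
      by (simp only: sum sum.empty)
    also have "\<dots> = 0" unfolding form_sum by simp
    finally have last: "k (Suc (rk \<gg>)) = 0" using marks_pos[of 0] by simp
    then have "(\<Sum>i\<le>rk \<gg>. smult \<gg> (k i) (coroot \<gg> i)) = 0"
      using sum by (simp add: cartan_basis_def)
    then show ?thesis using that(2) last coroot_independent by (auto simp: le_Suc_eq)
  qed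
  show inj: "inj_on cartan_basis {..Suc (rk \<gg>)}"
    and ind: "independent (cartan_basis ` {..Suc (rk \<gg>)})"
    using independent_family[of "{..Suc (rk \<gg>)}" cartan_basis] zero by auto
  have dim: "dim (cartan \<gg>) = rk \<gg> + 2"
    using realization by (simp add: realization_def)
  obtain T where T: "T \<subseteq> cartan \<gg>" "independent T" "cartan \<gg> \<subseteq> span T" "card T = dim (cartan \<gg>)"
    using basis_exists by blast
  show "cartan \<gg> \<subseteq> span (cartan_basis ` {..Suc (rk \<gg>)})"
  \<comment> \<open>The index set \<open>{..Suc (rk \<gg>)}\<close> has \<open>rk \<gg> + 2\<close>
    elements, which is the dimension prescribed by \<open>realization\<close>.\<close>
  proof (rule independent_spans[OF _ T(3)])
    show "finite T" using T(4) dim by (metis add_2_eq_Suc' card.infinite nat.distinct(1))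
    show "card T \<le> card (cartan_basis ` {..Suc (rk \<gg>)})"
      by (simp add: card_image[OF inj] T(4) dim)
    show "cartan_basis ` {..Suc (rk \<gg>)} \<subseteq> cartan \<gg>" by (auto simp: cartan_basis_def)
  qed (use ind in auto)
qed

lemma dual_eqI:
  assumes "\<Lambda> \<in> dual \<gg>" and "\<Lambda>' \<in> dual \<gg>"
    and "\<And>i. i \<le> rk \<gg> \<Longrightarrow> \<Lambda> (coroot \<gg> i) = \<Lambda>' (coroot \<gg> i)"
    and "\<Lambda> (scaling \<gg>) = \<Lambda>' (scaling \<gg>)"
  shows "\<Lambda> = \<Lambda>'"
proof
  fix x
  show "\<Lambda> x = \<Lambda>' x"
  proof (cases "x \<in> cartan \<gg>")
    case True
    then obtain k where "x = (\<Sum>i\<in>{..Suc (rk \<gg>)}. smult \<gg> (k i) (cartan_basis i))"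
      using span_family[OF _ inj_cartan_basis] cartan_span by blast
    moreover have "cartan_basis i \<in> cartan \<gg>" for i by (simp add: cartan_basis_def)
    ultimately show ?thesis
      using assms(3,4) by (simp only: dual_sum[OF assms(1)] dual_sum[OF assms(2)] finite_atMost)
        (simp add: cartan_basis_def)
  qed (use assms(1,2) in \<open>simp add: dual_def\<close>)
qed

text \<open>The coroot at vertex 0 has coefficient 1 in the central element, so its value is
  recovered from the remaining data.\<close>

lemma dual_eqI_central:
  assumes "\<Lambda> \<in> dual \<gg>" and "\<Lambda>' \<in> dual \<gg>"
    and J: "\<And>i. i \<in> J \<Longrightarrow> \<Lambda> (coroot \<gg> i) = \<Lambda>' (coroot \<gg> i)"
    and c: "\<Lambda> (central \<gg>) = \<Lambda>' (central \<gg>)"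
    and d: "\<Lambda> (scaling \<gg>) = \<Lambda>' (scaling \<gg>)"
  shows "\<Lambda> = \<Lambda>'"
proof (rule dual_eqI[OF assms(1,2) _ d])
  have "\<Lambda> (coroot \<gg> 0) = \<Lambda>' (coroot \<gg> 0)"
    using c J by (simp add: dual_central assms(1,2))
  then show "\<Lambda> (coroot \<gg> i) = \<Lambda>' (coroot \<gg> i)" if "i \<le> rk \<gg>" for i
    using that J by (cases "i = 0") auto
qed

lemma Lambda0:
  shows Lambda0_dual: "Lambda0 \<gg> \<in> dual \<gg>"
    and Lambda0_coroot: "i \<le> rk \<gg> \<Longrightarrow> Lambda0 \<gg> (coroot \<gg> i) = (if i = 0 then 1 else 0)"
proof -
  define P where "P \<Lambda> \<longleftrightarrow> \<Lambda> \<in> dual \<gg> \<and>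
    (\<forall>i\<le>rk \<gg>. \<Lambda> (coroot \<gg> i) = (if i = 0 then 1 else 0)) \<and> \<Lambda> (scaling \<gg>) = 0" for \<Lambda>
  interpret vector_space_pair "smult \<gg>" "(*) :: complex \<Rightarrow> complex \<Rightarrow> complex"
    by unfold_locales (auto simp: algebra_simps)
  obtain g where g: "Vector_Spaces.linear (smult \<gg>) (*) g"
    and val: "\<And>x. x \<in> cartan_basis ` {..Suc (rk \<gg>)} \<Longrightarrow> g x = (if x = cartan_basis 0 then 1 else 0)"
    using linear_independent_extend[OF independent_cartan_basis, of "\<lambda>x. if x = cartan_basis 0 then 1 else 0"]
    by blast
  have val': "g (cartan_basis i) = (if i = 0 then 1 else 0)" if "i \<le> Suc (rk \<gg>)" for i
    using val[of "cartan_basis i"] that inj_onD[OF inj_cartan_basis, of i 0] by auto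
  \<comment> \<open>The linear extension \<open>g\<close> lives on the whole algebra; membership in
    \<open>dual\<close> requires cutting it off outside the Cartan subalgebra.\<close>
  define \<Lambda> where "\<Lambda> x = (if x \<in> cartan \<gg> then g x else 0)" for x
  have "\<Lambda> \<in> dual \<gg>"
    using linear_add[OF g] linear_scale[OF g] cartan_subspace
    by (auto simp: dual_def \<Lambda>_def subspace_def)
  moreover have "\<Lambda> (coroot \<gg> i) = (if i = 0 then 1 else 0)" if "i \<le> rk \<gg>" for i
    using val'[of i] that by (simp add: \<Lambda>_def cartan_basis_def)
  moreover have "\<Lambda> (scaling \<gg>) = 0"
    using val'[of "Suc (rk \<gg>)"] by (simp add: \<Lambda>_def cartan_basis_def)
  ultimately have "P \<Lambda>" by (simp add: P_def)
  moreover have "\<Lambda>' = \<Lambda>" if "P \<Lambda>'" for \<Lambda>'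
    using that \<open>P \<Lambda>\<close> by (intro dual_eqI) (auto simp: P_def)
  ultimately have "P (THE \<Lambda>. P \<Lambda>)" by (rule theI)
  then have "P (Lambda0 \<gg>)" by (simp add: Lambda0_def P_def)
  then show "Lambda0 \<gg> \<in> dual \<gg>"
    and "i \<le> rk \<gg> \<Longrightarrow> Lambda0 \<gg> (coroot \<gg> i) = (if i = 0 then 1 else 0)"
    by (auto simp: P_def)
qed

lemma dual_linear_combination:
  assumes "finite I" and "\<And>i. i \<in> I \<Longrightarrow> \<Lambda> i \<in> dual \<gg>"
  shows "(\<lambda>x. \<Sum>i\<in>I. k i * \<Lambda> i x) \<in> dual \<gg>"
  using assms by (auto simp: dual_def sum.distrib sum_distrib_left algebra_simps intro!: sum.cong)

text \<open>A kernel vector gives a combination of simple roots vanishing on the finite coroots. All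
  roots kill \<open>central\<close>, and the finite ones kill \<open>scaling\<close>, so it is the
  zero functional and independence of the roots applies.\<close>

lemma finite_GCM_injective:
  fixes k :: "nat \<Rightarrow> complex"
  assumes k: "\<And>i. i \<in> J \<Longrightarrow> (\<Sum>j\<in>J. of_int (GCM \<gg> i j) * k j) = 0" and "j \<in> J"
  shows "k j = 0"
proof -
  define F where "F x = (\<Sum>j\<in>J. k j * root \<gg> j x)" for x
  have "F = (\<lambda>x. \<Sum>j\<in>{}. k j * root \<gg> j x)"
  proof (rule dual_eqI_central)
    show "F \<in> dual \<gg>" unfolding F_def by (rule dual_linear_combination) auto
    show "(\<lambda>x. \<Sum>j\<in>{}. k j * root \<gg> j x) \<in> dual \<gg>" by (rule dual_linear_combination) auto
    show "F (coroot \<gg> i) = (\<Sum>j\<in>{}. k j * root \<gg> j (coroot \<gg> i))" if "i \<in> J" for i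
      using k[OF that] that by (simp add: F_def root_coroot mult.commute)
  qed (simp_all add: F_def root_central root_scaling)
  then have F: "F x = 0" for x by simp
  define k' where "k' i = (if i = 0 then 0 else k i)" for i
  have "(\<Sum>i\<le>rk \<gg>. k' i * root \<gg> i x) = F x" for x
    by (simp add: sum_atMost_split k'_def F_def)
  then have "k' j = 0" using root_independent[of k' j] F \<open>j \<in> J\<close> by simp
  then show ?thesis using \<open>j \<in> J\<close> by (simp add: k'_def)
qed

text \<open>The columns become vectors \<open>u j\<close> in the span of the finite coroots.
  Injectivity makes them independent, and there are as many of them as coroots, so they
  span.\<close>

lemma finite_GCM_surjective:
  fixes p :: "nat \<Rightarrow> real"
  shows "\<exists>q. \<forall>i\<in>J. (\<Sum>j\<in>J. of_int (GCM \<gg> i j) * q j) = p i"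
proof -
  have coroots: "k i = 0" if "(\<Sum>i\<in>J. smult \<gg> (k i) (coroot \<gg> i)) = 0" "i \<in> J" for k i
  proof -
    have "(\<Sum>i\<le>rk \<gg>. smult \<gg> (if i = 0 then 0 else k i) (coroot \<gg> i)) = 0"
      using that(1) by (simp add: sum_atMost_split)
    then show ?thesis using coroot_independent[of "\<lambda>i. if i = 0 then 0 else k i" i] that(2) by simp
  qed
  define u where "u j = (\<Sum>i\<in>J. smult \<gg> (of_int (GCM \<gg> i j)) (coroot \<gg> i))" for j
  have comb: "(\<Sum>j\<in>J. smult \<gg> (k j) (u j))
      = (\<Sum>i\<in>J. smult \<gg> (\<Sum>j\<in>J. of_int (GCM \<gg> i j) * k j) (coroot \<gg> i))" for k
  proof -
    have "(\<Sum>j\<in>J. smult \<gg> (k j) (u j))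
        = (\<Sum>j\<in>J. \<Sum>i\<in>J. smult \<gg> (of_int (GCM \<gg> i j) * k j) (coroot \<gg> i))"
      by (simp add: u_def scale_sum_right mult.commute)
    also have "\<dots> = (\<Sum>i\<in>J. \<Sum>j\<in>J. smult \<gg> (of_int (GCM \<gg> i j) * k j) (coroot \<gg> i))"
      by (rule sum.swap)
    finally show ?thesis by (simp add: scale_sum_left)
  qed
  have u: "k j = 0" if "(\<Sum>j\<in>J. smult \<gg> (k j) (u j)) = 0" "j \<in> J" for k j
    using coroots[OF that(1)[unfolded comb]] that(2) by (rule finite_GCM_injective)
  have u_indep: "inj_on u J" "independent (u ` J)"
    by (rule independent_family; use u in simp)+
  have coroots_inj: "inj_on (coroot \<gg>) J"
    by (rule independent_family(1); use coroots in simp)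
  have "span (coroot \<gg> ` J) \<subseteq> span (u ` J)"
  proof (rule independent_spans)
    show "card (coroot \<gg> ` J) \<le> card (u ` J)"
      using u_indep(1) coroots_inj by (simp add: card_image)
    show "u ` J \<subseteq> span (coroot \<gg> ` J)"
      unfolding u_def by (blast intro: span_sum span_scale span_base)
  qed (use u_indep in auto)
  moreover have "(\<Sum>i\<in>J. smult \<gg> (of_real (p i)) (coroot \<gg> i)) \<in> span (coroot \<gg> ` J)"
    by (blast intro: span_sum span_scale span_base)
  ultimately obtain q where "(\<Sum>i\<in>J. smult \<gg> (of_real (p i)) (coroot \<gg> i)) = (\<Sum>j\<in>J. smult \<gg> (q j) (u j))"
    using span_family[OF finite_simple_roots u_indep(1)] by blast
  then have "(\<Sum>i\<in>J. smult \<gg> ((\<Sum>j\<in>J. of_int (GCM \<gg> i j) * q j) - of_real (p i)) (coroot \<gg> i)) = 0"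
    by (simp add: comb scale_left_diff_distrib sum_subtractf)
  then have "(\<Sum>j\<in>J. of_int (GCM \<gg> i j) * q j) = of_real (p i)" if "i \<in> J" for i
    using coroots[OF _ that] by fastforce
  \<comment> \<open>The matrix entries are integers, so the real parts of a complex solution solve
    the real system.\<close>
  then have "Re (\<Sum>j\<in>J. of_int (GCM \<gg> i j) * q j) = p i" if "i \<in> J" for i
    using that by simp
  then have "(\<Sum>j\<in>J. of_int (GCM \<gg> i j) * Re (q j)) = p i" if "i \<in> J" for i
    using that by simp
  then show ?thesis by (intro exI[of _ "\<lambda>j. Re (q j)"]) blast
qed

text \<open>The marks serve as \<open>v\<close>: dropping the term of vertex 0 from the null
  relation of row \<open>i\<close> leaves \<open>- GCM \<gg> i 0 * \<a> 0\<close>, which is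
  nonnegative.\<close>

sublocale finite_cartan J "GCM \<gg>" "\<lambda>i. real (\<c> i) / real (\<a> i)" "\<lambda>i. real (\<a> i)"
proof
  fix i assume i: "i \<in> J"
  have "of_int (\<Sum>j\<le>rk \<gg>. GCM \<gg> i j * int (\<a> j)) = (0 :: real)"
    using GCM_row[of i] i by simp
  then have "(\<Sum>j\<in>J. of_int (GCM \<gg> i j) * real (\<a> j)) = - of_int (GCM \<gg> i 0) * real (\<a> 0)"
    by (simp add: sum_atMost_split)
  moreover have "GCM \<gg> i 0 \<le> 0" using i by (intro cartan_matrix_offdiag) auto
  ultimately show "0 \<le> (\<Sum>j\<in>J. of_int (GCM \<gg> i j) * real (\<a> j))"
    by (simp add: mult_nonpos_nonneg)
qed (use marks_pos GCM_symm cartan_matrix_offdiag cartan_matrix_diag finite_GCM_surjective in auto)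

section \<open>From root coordinates to functionals, and the finite Weyl group\<close>

definition root_comb :: "(nat \<Rightarrow> real) \<Rightarrow> 'g \<Rightarrow> complex" where
  "root_comb m x = (\<Sum>j\<in>J. of_real (m j) * root \<gg> j x)"

lemma root_comb_dual: "root_comb m \<in> dual \<gg>"
  unfolding root_comb_def[abs_def] by (rule dual_linear_combination) auto

lemma root_comb_coroot: "i \<in> J \<Longrightarrow> root_comb m (coroot \<gg> i) = of_real (co m i)"
  by (simp add: root_comb_def co_def root_coroot mult.commute)

lemma root_comb_central: "root_comb m (central \<gg>) = 0"
  by (simp add: root_comb_def root_central)

lemma root_comb_scaling: "root_comb m (scaling \<gg>) = 0"
  by (simp add: root_comb_def root_scaling)

lemma root_comb_diff: "root_comb (\<lambda>j. m j - m' j) x = root_comb m x - root_comb m' x"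
  by (simp add: root_comb_def sum_subtractf algebra_simps)

lemma root_comb_scale: "root_comb (\<lambda>j. c * m j) x = of_real c * root_comb m x"
  by (simp add: root_comb_def sum_distrib_left mult_ac)

text \<open>The summand \<open>\<Xi>\<close> is fixed by the reflection. Later it carries the
  multiples of \<open>Lambda0\<close> and \<delta>, so that the Weyl group moves only root
  coordinates.\<close>

lemma reflection_root_comb:
  assumes "k \<in> J" and "\<Xi> (coroot \<gg> k) = 0"
  shows "reflection \<gg> k (\<lambda>x. \<Xi> x + root_comb m x) = (\<lambda>x. \<Xi> x + root_comb (simple_refl k m) x)"
proof
  fix x
  have "root_comb (\<lambda>j. if j = k then co m k else 0) x = of_real (co m k) * root \<gg> k x"
    using assms(1) by (simp add: root_comb_def if_distrib if_distribR cong: if_cong)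
  then show "reflection \<gg> k (\<lambda>x. \<Xi> x + root_comb m x) x = \<Xi> x + root_comb (simple_refl k m) x"
    using assms by (simp add: reflection_def root_comb_coroot simple_refl_def root_comb_diff)
qed

lemma fin_weyl_act:
  assumes "ks \<in> lists J" and "\<And>k. k \<in> J \<Longrightarrow> \<Xi> (coroot \<gg> k) = 0"
  shows "\<exists>w\<in>fin_weyl \<gg>. w (\<lambda>x. \<Xi> x + root_comb m x) = (\<lambda>x. \<Xi> x + root_comb (act ks m) x)"
  using assms(1)
proof (induction ks)
  case Nil
  then show ?case by (intro bexI[OF _ fin_weyl.id]) simp
next
  case (Cons k ks)
  then obtain w where w: "w \<in> fin_weyl \<gg>" "w (\<lambda>x. \<Xi> x + root_comb m x) = (\<lambda>x. \<Xi> x + root_comb (act ks m) x)"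
    by auto
  have k: "k \<in> J" using Cons.hyps by simp
  have "reflection \<gg> k \<circ> w \<in> fin_weyl \<gg>"
    using fin_weyl.reflect[OF w(1), of k] k by simp
  moreover have "(reflection \<gg> k \<circ> w) (\<lambda>x. \<Xi> x + root_comb m x) = (\<lambda>x. \<Xi> x + root_comb (act (k # ks) m) x)"
    using reflection_root_comb[where \<Xi> = \<Xi>, OF k assms(2)[OF k]] by (simp add: w(2))
  ultimately show ?case by blast
qed

end

section \<open>The lattice M and the vector \<theta> in coordinates\<close>

lemma additive_span_diff:
  assumes "y \<in> additive_span S" and "x \<in> additive_span S"
  shows "(\<lambda>t. x t - y t) \<in> additive_span S"
  using assms(1)
proof induction
  case zero
  then show ?case using assms(2) by simp
next
  case (add y \<beta>)
  then show ?case using additive_span.sub[of "\<lambda>t. x t - y t" S \<beta>] by (simp add: algebra_simps)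
next
  case (sub y \<beta>)
  then show ?case using additive_span.add[of "\<lambda>t. x t - y t" S \<beta>] by (simp add: algebra_simps)
qed

text \<open>Reflections are additive and permute the generators, which form a full Weyl
  orbit.\<close>

lemma lattice_M_reflection:
  assumes "x \<in> lattice_M \<gg>" and "k \<in> {1..rk \<gg>}"
  shows "reflection \<gg> k x \<in> lattice_M \<gg>"
proof -
  let ?S = "(\<lambda>w. w (\<lambda>x. theta \<gg> x / of_nat (mark (dynkin \<gg>) 0))) ` fin_weyl \<gg>"
  have refl_S: "reflection \<gg> k \<beta> \<in> ?S" if \<beta>: "\<beta> \<in> ?S" for \<beta>
  proof -
    obtain w where "w \<in> fin_weyl \<gg>" "\<beta> = w (\<lambda>x. theta \<gg> x / of_nat (mark (dynkin \<gg>) 0))"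
      using \<beta> by blast
    then show ?thesis
      using fin_weyl.reflect[OF _ assms(2)] by (intro image_eqI[of _ _ "reflection \<gg> k \<circ> w"]) auto
  qed
  show ?thesis
    using assms(1) unfolding lattice_M_def
  proof induction
    case zero
    then show ?case using additive_span.zero by (simp add: reflection_def)
  next
    case (add y \<beta>)
    then show ?case using additive_span.add[OF add.IH refl_S[OF add.hyps(2)]]
      by (simp add: reflection_def algebra_simps)
  next
    case (sub y \<beta>)
    then show ?case using additive_span.sub[OF sub.IH refl_S[OF sub.hyps(2)]]
      by (simp add: reflection_def algebra_simps)
  qed
qed

context affine_lie
begin

text \<open>Building integrality into the set means that it has to be checked only for the generator
  \<theta> / \<open>\<a> 0\<close> and under differences and reflections.\<close>

definition M_coords :: "(nat \<Rightarrow> real) set" where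
  "M_coords = {m. root_comb m \<in> lattice_M \<gg> \<and> (\<forall>i\<in>J. co m i \<in> \<int>) \<and> (\<forall>i\<in>J. real (\<a> 0) * m i \<in> \<int>)}"

text \<open>Removing the \<alpha>-term of vertex 0 from \<delta> leaves \<theta>; these are the
  coordinates of \<theta> / \<open>\<a> 0\<close>.\<close>

definition theta_coords :: "nat \<Rightarrow> real" where
  "theta_coords i = real (\<a> i) / real (\<a> 0)"

text \<open>Modulo a multiple of \<delta>, which vanishes on coroots, \<theta> /
  \<open>\<a> 0\<close> is the negative of the simple root at vertex 0.\<close>

lemma co_theta_coords:
  assumes "i \<in> J"
  shows "co theta_coords i = - of_int (GCM \<gg> i 0)"
proof -
  have "of_int (\<Sum>j\<le>rk \<gg>. GCM \<gg> i j * int (\<a> j)) = (0 :: real)"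
    using GCM_row[of i] assms by simp
  then have *: "(\<Sum>j\<in>J. of_int (GCM \<gg> i j) * real (\<a> j)) = - of_int (GCM \<gg> i 0) * real (\<a> 0)"
    by (simp add: sum_atMost_split)
  have "co theta_coords i = (\<Sum>j\<in>J. of_int (GCM \<gg> i j) * real (\<a> j)) / real (\<a> 0)"
    by (simp add: co_def theta_coords_def sum_divide_distrib)
  then show ?thesis using marks_pos(1)[of 0] by (simp add: *)
qed

text \<open>The weights \<open>\<c> i / \<a> i\<close> of the form cancel the marks in \<theta>. For
  a functional of level zero the right side is minus its value on the coroot at vertex 0, which
  links the alcove inequality to dominance there.\<close>

lemma bil_theta_coords_right: "real (\<a> 0) * bil x theta_coords = (\<Sum>i\<in>J. real (\<c> i) * co x i)"
proof -
  have "real (\<a> 0) * bil theta_coords x = (\<Sum>i\<in>J. real (\<c> i) * co x i)"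
    unfolding bil_def theta_coords_def sum_distrib_left
    using marks_pos by (intro sum.cong refl) (simp add: less_imp_neq[symmetric])
  then show ?thesis by (simp add: bil_commute)
qed

text \<open>Column 0 is annihilated by the comarks, so its part over \<open>J\<close> equals minus
  the diagonal entry 2.\<close>

lemma bil_theta_coords: "real (\<a> 0) * bil theta_coords theta_coords = 2"
proof -
  have "of_int (\<Sum>i\<le>rk \<gg>. int (\<c> i) * GCM \<gg> i 0) = (0 :: real)"
    using GCM_column[of 0] by simp
  then show ?thesis
    by (simp add: bil_theta_coords_right co_theta_coords sum_atMost_split comark_0 cartan_matrix_diag sum_negf)
qed

lemma root_comb_theta_coords: "root_comb theta_coords x = theta \<gg> x / of_nat (\<a> 0)"
  by (simp add: root_comb_def theta_coords_def theta_def null_root_def sum_atMost_split sum_divide_distrib)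

lemma theta_coords_in_M: "theta_coords \<in> M_coords"
proof -
  have "(\<lambda>x. 0 + id (\<lambda>x. theta \<gg> x / of_nat (\<a> 0)) x) \<in> lattice_M \<gg>"
    unfolding lattice_M_def by (intro additive_span.add additive_span.zero imageI fin_weyl.id)
  moreover have "root_comb theta_coords = (\<lambda>x. theta \<gg> x / of_nat (\<a> 0))"
    by (simp add: fun_eq_iff root_comb_theta_coords)
  ultimately show ?thesis
    using marks_pos(1)[of 0] by (simp add: M_coords_def co_theta_coords) (simp add: theta_coords_def)
qed

lemma M_coords_diff:
  assumes "x \<in> M_coords" and "y \<in> M_coords"
  shows "(\<lambda>j. x j - y j) \<in> M_coords"
proof -
  have "root_comb (\<lambda>j. x j - y j) = (\<lambda>t. root_comb x t - root_comb y t)" by (simp add: fun_eq_iff root_comb_diff)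
  then show ?thesis
    using assms by (auto simp: M_coords_def lattice_M_def additive_span_diff co_diff right_diff_distrib)
qed

lemma M_coords_simple_refl:
  assumes "x \<in> M_coords" and "k \<in> J"
  shows "simple_refl k x \<in> M_coords"
proof -
  have "reflection \<gg> k (root_comb x) = root_comb (simple_refl k x)"
    using reflection_root_comb[OF assms(2), of "\<lambda>_. 0" x] by simp
  then have "root_comb (simple_refl k x) \<in> lattice_M \<gg>"
    using lattice_M_reflection[of "root_comb x" \<gg> k] assms by (simp add: M_coords_def)
  moreover have "co (simple_refl k x) i \<in> \<int>" if "i \<in> J" for i
    using assms that by (intro co_simple_refl_Ints) (auto simp: M_coords_def)
  moreover have "real (\<a> 0) * simple_refl k x i \<in> \<int>" if "i \<in> J" for i
    using assms that by (auto simp: M_coords_def simple_refl_def right_diff_distrib)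
  ultimately show ?thesis by (simp add: M_coords_def)
qed

end

section \<open>Transfer of the alcove statement to weights\<close>

theorem proposition1:
  fixes \<gg> :: "'g::ab_group_add affine_data"
    and l :: nat
    and lam :: "'g \<Rightarrow> complex"
  assumes "affine_lie_algebra \<gg>"
    and "l > 0"
    and "lam \<in> fin_dominant_weights \<gg>"
  shows "\<exists>\<mu>\<in>lattice_M_plus \<gg>. \<exists>w\<in>fin_weyl \<gg>.
    w (translation \<gg> \<mu> (\<lambda>x. of_nat l * Lambda0 \<gg> x - lam x)) \<in> dominant_weights \<gg>"
proof -
  interpret affine_lie \<gg> by unfold_locales fact
  have lam: "lam \<in> dual \<gg>" "lam (central \<gg>) = 0" "lam (scaling \<gg>) = 0"
    "\<And>i. i \<in> J \<Longrightarrow> lam (coroot \<gg> i) \<in> \<int>" "\<And>i. i \<in> J \<Longrightarrow> 0 \<le> Re (lam (coroot \<gg> i))"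
    using assms(3) by (auto simp: fin_dominant_weights_def fin_weight_lattice_def fin_dual_def)
  obtain q where "\<forall>i\<in>J. (\<Sum>j\<in>J. of_int (GCM \<gg> i j) * q j) = Re (lam (coroot \<gg> i))"
    using finite_GCM_surjective[of "\<lambda>i. Re (lam (coroot \<gg> i))"] by blast
  then have q: "co q i = Re (lam (coroot \<gg> i))" if "i \<in> J" for i
    using that by (simp add: co_def)
  have lam_root_comb: "lam = root_comb q"
  proof (rule dual_eqI_central[OF lam(1) root_comb_dual])
    fix i assume "i \<in> J"
    then show "lam (coroot \<gg> i) = root_comb q (coroot \<gg> i)"
      using lam(4)[of i] by (auto simp: root_comb_coroot q elim!: Ints_cases)
  qed (simp_all add: lam root_comb_central root_comb_scaling)
  \<comment> \<open>The product of the marks is a common multiple of the denominators of the weights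
    \<open>\<c> i / \<a> i\<close>.\<close>
  define K where "K = (\<Prod>i\<in>J. real (\<a> i))"
  have K: "K * (real (\<c> i) / real (\<a> i)) \<in> \<int>" if "i \<in> J" for i
  proof -
    have "K = real (\<a> i) * real (\<Prod>i\<in>J - {i}. \<a> i)"
      using that by (simp add: K_def prod.remove)
    then have "K * (real (\<c> i) / real (\<a> i)) = of_nat ((\<Prod>i\<in>J - {i}. \<a> i) * \<c> i)"
      using marks_pos(1)[of i] that by simp
    then show ?thesis by (simp only: Ints_of_nat)
  qed
  have "K > 0" using marks_pos by (auto simp: K_def intro!: prod_pos)
  have zero: "(\<lambda>_. 0) \<in> M_coords"
    using M_coords_diff[OF theta_coords_in_M theta_coords_in_M] by simp
  have "\<exists>\<mu>\<in>M_coords. \<exists>ks\<in>lists J. \<exists>x. x = act ks (\<lambda>j. real l * \<mu> j - q j) \<and> (\<forall>i\<in>J. 0 \<le> co \<mu> i) \<and>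
    (\<forall>i\<in>J. 0 \<le> co x i) \<and> (\<forall>i\<in>J. co x i \<in> \<int>) \<and>
    2 * bil x theta_coords \<le> real l * bil theta_coords theta_coords"
  proof (rule ex_translate_in_alcove[OF zero M_coords_diff M_coords_simple_refl _ _ _ \<open>K > 0\<close> K
        \<open>l > 0\<close> theta_coords_in_M])
    show "\<a> 0 > 0" using marks_pos by simp
    show "co q i \<in> \<int>" "0 \<le> co q i" if "i \<in> J" for i
      using lam(4,5)[OF that] unfolding q[OF that] by (auto elim!: Ints_cases)
  qed (auto simp: M_coords_def)
  then obtain m ks x where m: "m \<in> M_coords" "\<forall>i\<in>J. 0 \<le> co m i"
    and ks: "ks \<in> lists J" "x = act ks (\<lambda>j. real l * m j - q j)"
    and x: "\<forall>i\<in>J. 0 \<le> co x i" "\<forall>i\<in>J. co x i \<in> \<int>"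
    "2 * bil x theta_coords \<le> real l * bil theta_coords theta_coords"
    by blast
  have "root_comb m \<in> lattice_M_plus \<gg>"
    using m by (auto simp: lattice_M_plus_def M_coords_def fin_chamber_def fin_dual_real_def fin_dual_def
        root_comb_dual root_comb_central root_comb_scaling root_comb_coroot)
  let ?\<Lambda> = "\<lambda>x. of_nat l * Lambda0 \<gg> x - lam x"
  define \<kappa> where "\<kappa> = dual_form \<gg> ?\<Lambda> (root_comb m)
      + dual_form \<gg> (root_comb m) (root_comb m) / 2 * ?\<Lambda> (central \<gg>)"
  \<comment> \<open>This collects what the finite Weyl group fixes. The \<delta>-coefficient
    \<open>\<kappa>\<close> is never computed, since \<delta> vanishes on every coroot.\<close>
  define \<Xi> where "\<Xi> x = of_nat l * Lambda0 \<gg> x - \<kappa> * null_root \<gg> x" for x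
  have "Lambda0 \<gg> (central \<gg>) = 1"
    by (simp add: dual_central Lambda0_dual Lambda0_coroot)
  then have "?\<Lambda> (central \<gg>) = of_nat l" by (simp add: lam)
  moreover have "translation \<gg> (root_comb m) ?\<Lambda>
      = (\<lambda>x. ?\<Lambda> x + ?\<Lambda> (central \<gg>) * root_comb m x - \<kappa> * null_root \<gg> x)"
    by (simp only: translation_def \<kappa>_def)
  ultimately have translation: "translation \<gg> (root_comb m) ?\<Lambda>
      = (\<lambda>x. \<Xi> x + root_comb (\<lambda>j. real l * m j - q j) x)"
    by (simp add: \<Xi>_def root_comb_diff root_comb_scale fun_eq_iff) (simp add: lam_root_comb)
  have null_coroot: "null_root \<gg> (coroot \<gg> i) = 0" if "i \<le> rk \<gg>" for i
  proof -
    have "null_root \<gg> (coroot \<gg> i) = of_int (\<Sum>j\<le>rk \<gg>. GCM \<gg> i j * int (\<a> j))"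
      using that by (simp add: null_root_def root_coroot mult.commute)
    then show ?thesis using GCM_row[OF that] by simp
  qed
  have "\<Xi> (coroot \<gg> i) = 0" if "i \<in> J" for i
    using that by (simp add: \<Xi>_def null_coroot Lambda0_coroot)
  then obtain w where w: "w \<in> fin_weyl \<gg>"
      "w (translation \<gg> (root_comb m) ?\<Lambda>) = (\<lambda>t. \<Xi> t + root_comb x t)"
    using fin_weyl_act[OF ks(1), of \<Xi>] unfolding translation ks(2) by blast
  have null_dual: "null_root \<gg> \<in> dual \<gg>"
    unfolding null_root_def[abs_def] by (rule dual_linear_combination) auto
  have "(\<lambda>t. \<Xi> t + root_comb x t) \<in> dual \<gg>"
    using Lambda0_dual root_comb_dual[of x] null_dual by (simp add: dual_def \<Xi>_def algebra_simps)
  moreover have "\<exists>r\<in>\<int>. 0 \<le> r \<and>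
      \<Xi> (coroot \<gg> i) + root_comb x (coroot \<gg> i) = complex_of_real r" if i: "i \<le> rk \<gg>" for i
  proof (cases "i = 0")
    case False
    then have "i \<in> J" using i by simp
    then have "\<Xi> (coroot \<gg> i) + root_comb x (coroot \<gg> i) = of_real (co x i)"
      by (simp add: \<Xi>_def null_coroot Lambda0_coroot root_comb_coroot)
    then show ?thesis using x(1,2) \<open>i \<in> J\<close> by blast
  next
    case True
    define r where "r = real l - (\<Sum>i\<in>J. \<c> i * co x i)"
    \<comment> \<open>Root combinations vanish on \<open>central\<close>, so the value at vertex 0
      is determined by the finite coroots.\<close>
    have "root_comb x (coroot \<gg> 0) = - (\<Sum>i\<in>J. of_nat (\<c> i) * of_real (co x i))"
      using dual_central[OF root_comb_dual, of x]
      by (simp add: root_comb_central root_comb_coroot eq_neg_iff_add_eq_0)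
    then have "\<Xi> (coroot \<gg> i) + root_comb x (coroot \<gg> i) = of_real r"
      by (simp add: True r_def \<Xi>_def null_coroot Lambda0_coroot)
    \<comment> \<open>Multiplied by \<open>\<a> 0\<close>, the alcove inequality compares twice the
      sum in \<open>r\<close> with \<open>2 * l\<close>.\<close>
    moreover have "real (\<a> 0) * (2 * bil x theta_coords) \<le> real (\<a> 0) * (l * bil theta_coords theta_coords)"
      using x(3) by (intro mult_left_mono) auto
    then have "0 \<le> r"
      using bil_theta_coords_right[of x] bil_theta_coords by (simp add: r_def mult.left_commute)
    moreover have "r \<in> \<int>"
      unfolding r_def using x(2) by (intro Ints_diff Ints_sum Ints_mult) auto
    ultimately show ?thesis by blast
  qed
  then have "\<Xi> (coroot \<gg> i) + root_comb x (coroot \<gg> i) \<in> \<int> \<and>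
      0 \<le> Re (\<Xi> (coroot \<gg> i) + root_comb x (coroot \<gg> i))" if "i \<le> rk \<gg>" for i
    using that by (fastforce simp del: plus_complex.sel elim!: Ints_cases)
  ultimately have "(\<lambda>t. \<Xi> t + root_comb x t) \<in> dominant_weights \<gg>"
    unfolding dominant_weights_def weight_lattice_def by blast
  then have "w (translation \<gg> (root_comb m) ?\<Lambda>) \<in> dominant_weights \<gg>"
    by (simp only: w(2))
  then show ?thesis
    using w(1) \<open>root_comb m \<in> lattice_M_plus \<gg>\<close> by blast
qed

end
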